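(* Let $F$ be a field of characteristic $0$, let $H=(H,\mu,\Delta,\eta,\epsilon,S)$ be a cocommutative Hopf algebra over $F$ and let $B$ be a Rota-Baxter operator on $H$. Define $x*y=x_{(1)}B(x_{(2)})\,y\,S(B(x_{(3)}))$ for $x,y\in H$ and $S_B(x)=S(B(x_{(1)}))S(x_{(2)})B(x_{(3)})$ for $x\in H$. Then $H_B=(H,*,\Delta,\eta,\epsilon,S_B)$ is a cocommutative Hopf algebra (with multiplication $*$, comultiplication $\Delta$, unit $\eta$, counit $\epsilon$ and antipode $S_B$).
   Context: Sumless Sweedler notation $\Delta(x)=x_{(1)}\otimes x_{(2)}$ (and similarly for iterated comultiplications) is used. A linear map $B\colon H\to H$ of a coalgebra is a coalgebra map if $\Delta(B(x))=B(x_{(1)})\otimes B(x_{(2)})$ and $\epsilon(B(x))=\epsilon(x)$ for all $x$. If $H$ is a cocommutative Hopf algebra with antipode $S$, a Rota-Baxter operator on $H$ is a coalgebra map $B\colon H\to H$ such that $B(x)B(y)=B\big(x_{(1)}B(x_{(2)})\,y\,S(B(x_{(3)}))\big)$ for all $x,y\in H$. *)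

theory Defs
  imports Complex_Main "HOL-Library.Poly_Mapping"
begin

section \<open>Vector spaces presented by generators and relations\<close>

text \<open>
  The free vector space on \<open>'i\<close> over the field \<open>'f\<close> is the type \<open>'i \<Rightarrow>\<^sub>0 'f\<close> of finitely
  supported functions.
\<close>

definition gen :: "'i \<Rightarrow> ('i \<Rightarrow>\<^sub>0 'f::field)"
  where "gen i = Poly_Mapping.single i 1"

definition fscale :: "'f::field \<Rightarrow> ('i \<Rightarrow>\<^sub>0 'f) \<Rightarrow> ('i \<Rightarrow>\<^sub>0 'f)"
  where "fscale c u = Poly_Mapping.map ((*) c) u"

lemma lookup_fscale [simp]:
  "Poly_Mapping.lookup (fscale c u) i = c * Poly_Mapping.lookup u i"
  by (simp add: fscale_def Poly_Mapping.map.rep_eq when_def)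

global_interpretation formal: vector_space fscale
  by unfold_locales (auto intro!: poly_mapping_eqI simp: lookup_add algebra_simps)

definition extend ::
  "('f::field \<Rightarrow> 'v::ab_group_add \<Rightarrow> 'v) \<Rightarrow> ('i \<Rightarrow> 'v) \<Rightarrow> ('i \<Rightarrow>\<^sub>0 'f) \<Rightarrow> 'v"
  where "extend s f u = (\<Sum>i\<in>Poly_Mapping.keys u. s (Poly_Mapping.lookup u i) (f i))"

text \<open>
  The quotient of the free vector space by the span of a set \<open>R\<close> of relators. Its elements are
  the cosets of \<open>span R\<close>. The scale of the vector spaces below is a term and not part of a type,
  so this quotient is a set of cosets and not a type of its own.
\<close>

definition coset :: "('i \<Rightarrow>\<^sub>0 'f::field) set \<Rightarrow> ('i \<Rightarrow>\<^sub>0 'f) \<Rightarrow> ('i \<Rightarrow>\<^sub>0 'f) set"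
  where "coset R u = {v. v - u \<in> formal.span R}"

definition presented_space :: "('i \<Rightarrow>\<^sub>0 'f::field) set \<Rightarrow> ('i \<Rightarrow>\<^sub>0 'f) set set"
  where "presented_space R = range (coset R)"

definition rep :: "('i \<Rightarrow>\<^sub>0 'f::field) set \<Rightarrow> ('i \<Rightarrow>\<^sub>0 'f)"
  where "rep A = (SOME u. u \<in> A)"

definition coset_add ::
  "('i \<Rightarrow>\<^sub>0 'f::field) set \<Rightarrow> ('i \<Rightarrow>\<^sub>0 'f) set \<Rightarrow> ('i \<Rightarrow>\<^sub>0 'f) set \<Rightarrow> ('i \<Rightarrow>\<^sub>0 'f) set"
  where "coset_add R A A' = coset R (rep A + rep A')"

definition coset_scale ::
  "('i \<Rightarrow>\<^sub>0 'f::field) set \<Rightarrow> 'f \<Rightarrow> ('i \<Rightarrow>\<^sub>0 'f) set \<Rightarrow> ('i \<Rightarrow>\<^sub>0 'f) set"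
  where "coset_scale R c A = coset R (fscale c (rep A))"

lemma coset_eq_iff: "coset R u = coset R v \<longleftrightarrow> u - v \<in> formal.span R"
proof
  assume "coset R u = coset R v"
  moreover have "u \<in> coset R u" by (simp add: coset_def formal.span_zero)
  ultimately show "u - v \<in> formal.span R" by (simp add: coset_def)
next
  assume *: "u - v \<in> formal.span R"
  have "w - u \<in> formal.span R \<longleftrightarrow> w - v \<in> formal.span R" for w
    using formal.span_add[OF _ *, of "w - u"] formal.span_diff[OF _ *, of "w - v"] by auto
  then show "coset R u = coset R v" by (simp add: coset_def)
qed

lemma coset_rep: "A \<in> presented_space R \<Longrightarrow> coset R (rep A) = A"
proof -
  assume "A \<in> presented_space R"
  then obtain u where A: "A = coset R u" by (auto simp: presented_space_def)
  have "u \<in> A" by (simp add: A coset_def formal.span_zero)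
  then have "rep A \<in> A" unfolding rep_def by (rule someI)
  then show ?thesis unfolding A by (simp add: coset_eq_iff) (simp add: coset_def)
qed

lemma coset_add_coset [simp]: "coset_add R (coset R u) (coset R v) = coset R (u + v)"
proof -
  have "rep (coset R u) - u \<in> formal.span R" "rep (coset R v) - v \<in> formal.span R"
    by (simp_all add: coset_rep presented_space_def flip: coset_eq_iff)
  from formal.span_add[OF this] show ?thesis
    by (simp add: coset_add_def coset_eq_iff algebra_simps)
qed

lemma coset_scale_coset [simp]: "coset_scale R c (coset R u) = coset R (fscale c u)"
proof -
  have "rep (coset R u) - u \<in> formal.span R"
    by (simp add: coset_rep presented_space_def flip: coset_eq_iff)
  from formal.span_scale[OF this] show ?thesis
    by (simp add: coset_scale_def coset_eq_iff formal.scale_right_diff_distrib)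
qed

context vector_space
begin

lemma extend_superset:
  assumes "finite K" "Poly_Mapping.keys u \<subseteq> K"
  shows "extend scale f u = (\<Sum>i\<in>K. scale (Poly_Mapping.lookup u i) (f i))"
  unfolding extend_def using assms
  by (intro sum.mono_neutral_left) (auto simp: in_keys_iff)

lemma extend_gen [simp]: "extend scale f (gen i) = f i"
  by (simp add: extend_def gen_def)

lemma extend_add: "extend scale f (u + v) = extend scale f u + extend scale f v"
proof -
  let ?K = "Poly_Mapping.keys u \<union> Poly_Mapping.keys v"
  have "Poly_Mapping.keys (u + v) \<subseteq> ?K" by (rule keys_add)
  then show ?thesis
    by (simp add: extend_superset[of ?K] lookup_add scale_left_distrib sum.distrib)
qed

lemma extend_fscale: "extend scale f (fscale c u) = scale c (extend scale f u)"
proof -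
  have "Poly_Mapping.keys (fscale c u) \<subseteq> Poly_Mapping.keys u" by (auto simp: in_keys_iff)
  then show ?thesis
    by (simp add: extend_superset[of "Poly_Mapping.keys u"] scale_sum_right)
qed

lemma linear_extend: "Vector_Spaces.linear fscale scale (extend scale f)"
  by unfold_locales (simp_all add: extend_add extend_fscale)

text \<open>
  The value of \<open>extend scale f\<close> does not depend on the representative of a coset, modulo a
  subspace \<open>W\<close>, once the relators are sent into \<open>W\<close>.
\<close>

lemma extend_cong_mod:
  assumes "subspace W" "\<And>r. r \<in> R \<Longrightarrow> extend scale f r \<in> W" "coset R u = coset R v"
  shows "extend scale f u - extend scale f v \<in> W"
proof -
  interpret L: Vector_Spaces.linear fscale scale "extend scale f" by (rule linear_extend)
  have "extend scale f ` formal.span R \<subseteq> W"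
    unfolding L.span_image[symmetric] using assms(1,2) by (intro span_minimal) auto
  moreover have "u - v \<in> formal.span R" using assms(3) by (simp add: coset_eq_iff)
  ultimately show ?thesis by (auto simp: L.diff[symmetric])
qed

end


section \<open>Tensor products and Sweedler notation\<close>

text \<open>
  \<open>H \<otimes> H\<close> and \<open>H \<otimes> H \<otimes> H\<close> for a vector space \<open>H\<close> with scale \<open>s\<close> are the quotients of the free
  vector spaces on \<open>H \<times> H\<close> and \<open>H \<times> H \<times> H\<close> by the following relators. The tensor
  \<open>x \<otimes> y\<close> is the coset of \<open>gen (x, y)\<close>.
\<close>

definition relators2 :: "('f::field \<Rightarrow> 'a::ab_group_add \<Rightarrow> 'a) \<Rightarrow> ('a \<times> 'a \<Rightarrow>\<^sub>0 'f) set"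
  where "relators2 s =
    {gen (x + x', y) - (gen (x, y) + gen (x', y)) | x x' y. True} \<union>
    {gen (x, y + y') - (gen (x, y) + gen (x, y')) | x y y'. True} \<union>
    {gen (s c x, y) - fscale c (gen (x, y)) | c x y. True} \<union>
    {gen (x, s c y) - fscale c (gen (x, y)) | c x y. True}"

definition relators3 ::
  "('f::field \<Rightarrow> 'a::ab_group_add \<Rightarrow> 'a) \<Rightarrow> ('a \<times> 'a \<times> 'a \<Rightarrow>\<^sub>0 'f) set"
  where "relators3 s =
    {gen (x + x', y, z) - (gen (x, y, z) + gen (x', y, z)) | x x' y z. True} \<union>
    {gen (x, y + y', z) - (gen (x, y, z) + gen (x, y', z)) | x y y' z. True} \<union>
    {gen (x, y, z + z') - (gen (x, y, z) + gen (x, y, z')) | x y z z'. True} \<union>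
    {gen (s c x, y, z) - fscale c (gen (x, y, z)) | c x y z. True} \<union>
    {gen (x, s c y, z) - fscale c (gen (x, y, z)) | c x y z. True} \<union>
    {gen (x, y, s c z) - fscale c (gen (x, y, z)) | c x y z. True}"

type_synonym ('a, 'f) tensor2 = "('a \<times> 'a \<Rightarrow>\<^sub>0 'f) set"

definition bilinear_map ::
  "('f::field \<Rightarrow> 'a::ab_group_add \<Rightarrow> 'a) \<Rightarrow> ('f \<Rightarrow> 'v::ab_group_add \<Rightarrow> 'v) \<Rightarrow> ('a \<Rightarrow> 'a \<Rightarrow> 'v) \<Rightarrow> bool"
  where "bilinear_map s t f \<longleftrightarrow>
    (\<forall>x. Vector_Spaces.linear s t (f x)) \<and> (\<forall>y. Vector_Spaces.linear s t (\<lambda>x. f x y))"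

text \<open>
  \<open>sweedler t \<Delta> f x\<close> is the expression \<open>f x\<^sub>(\<^sub>1\<^sub>) x\<^sub>(\<^sub>2\<^sub>)\<close> in a vector space with scale \<open>t\<close>, that is,
  \<open>\<Sum> c\<^sub>i f a\<^sub>i b\<^sub>i\<close> where \<open>\<Delta> x = \<Sum> c\<^sub>i a\<^sub>i \<otimes> b\<^sub>i\<close>. For bilinear \<open>f\<close> it does not depend on the
  representative of \<open>\<Delta> x\<close>, by \<open>sweedler_eq\<close>. When \<open>t\<close> is \<open>fscale\<close>, the value is a formal sum
  that represents a tensor, and \<open>f\<close> need only be bilinear modulo the relators
  (cf. \<open>extend_cong_mod\<close>).
\<close>

definition sweedler ::
  "('f::field \<Rightarrow> 'v::ab_group_add \<Rightarrow> 'v) \<Rightarrow> ('a \<Rightarrow> ('a, 'f) tensor2) \<Rightarrow> ('a \<Rightarrow> 'a \<Rightarrow> 'v) \<Rightarrow> 'a \<Rightarrow> 'v"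
  where "sweedler t \<Delta> f x = extend t (\<lambda>(a, b). f a b) (rep (\<Delta> x))"

text \<open>\<open>f x\<^sub>(\<^sub>1\<^sub>) x\<^sub>(\<^sub>2\<^sub>) x\<^sub>(\<^sub>3\<^sub>)\<close>, read off from \<open>(\<Delta> \<otimes> id) (\<Delta> x)\<close>\<close>

definition sweedler3 ::
  "('f::field \<Rightarrow> 'v::ab_group_add \<Rightarrow> 'v) \<Rightarrow> ('a \<Rightarrow> ('a, 'f) tensor2) \<Rightarrow>
    ('a \<Rightarrow> 'a \<Rightarrow> 'a \<Rightarrow> 'v) \<Rightarrow> 'a \<Rightarrow> 'v"
  where "sweedler3 t \<Delta> f x = sweedler t \<Delta> (\<lambda>y c. sweedler t \<Delta> (\<lambda>a b. f a b c) y) x"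

lemma sweedler_eq:
  assumes "bilinear_map s t f" and u: "\<Delta> x = coset (relators2 s) u"
  shows "sweedler t \<Delta> f x = extend t (\<lambda>(a, b). f a b) u"
proof -
  let ?f = "\<lambda>(a, b). f a b"
  interpret f1: Vector_Spaces.linear s t "f a" for a
    using assms(1) by (simp add: bilinear_map_def)
  interpret f2: Vector_Spaces.linear s t "\<lambda>a. f a b" for b
    using assms(1) by (simp add: bilinear_map_def)
  interpret L: Vector_Spaces.linear fscale t "extend t ?f" by (rule f1.vs2.linear_extend)
  have "extend t ?f r \<in> {0}" if "r \<in> relators2 s" for r
    using that unfolding relators2_def
    by (auto simp: L.diff L.add L.scale f1.add f1.scale f2.add f2.scale)
  moreover have "coset (relators2 s) (rep (\<Delta> x)) = coset (relators2 s) u"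
    unfolding u by (rule coset_rep) (simp add: presented_space_def)
  ultimately have "extend t ?f (rep (\<Delta> x)) - extend t ?f u \<in> {0}"
    by (intro f1.vs2.extend_cong_mod[where R = "relators2 s"]) (auto simp: f1.vs2.subspace_single_0)
  then show ?thesis by (simp add: sweedler_def)
qed


section \<open>Hopf algebras\<close>

locale unital_algebra = vector_space scale
  for scale :: "'f::field \<Rightarrow> 'a::ab_group_add \<Rightarrow> 'a" +
  fixes \<mu> :: "'a \<Rightarrow> 'a \<Rightarrow> 'a" and \<eta> :: "'f \<Rightarrow> 'a"
  assumes mult_bilinear: "bilinear_map scale scale \<mu>"
    and unit_linear: "Vector_Spaces.linear (*) scale \<eta>"
    and mult_assoc: "\<mu> (\<mu> x y) z = \<mu> x (\<mu> y z)"
    and unit_left: "\<mu> (\<eta> c) x = scale c x"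
    and unit_right: "\<mu> x (\<eta> c) = scale c x"

text \<open>Both iterated tensor products of three copies of \<open>H\<close> are identified with \<open>H \<otimes> H \<otimes> H\<close>
  in \<open>coassoc\<close>, and \<open>F \<otimes> H\<close> and \<open>H \<otimes> F\<close> with \<open>H\<close> in the counit laws.\<close>

locale counital_coalgebra = vector_space scale
  for scale :: "'f::field \<Rightarrow> 'a::ab_group_add \<Rightarrow> 'a" +
  fixes \<Delta> :: "'a \<Rightarrow> ('a, 'f) tensor2" and \<epsilon> :: "'a \<Rightarrow> 'f"
  assumes comult_in: "\<Delta> x \<in> presented_space (relators2 scale)"
    and comult_add: "\<Delta> (x + y) = coset_add (relators2 scale) (\<Delta> x) (\<Delta> y)"
    and comult_scale: "\<Delta> (scale c x) = coset_scale (relators2 scale) c (\<Delta> x)"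
    and counit_linear: "Vector_Spaces.linear scale (*) \<epsilon>"
    and coassoc:
      "coset (relators3 scale)
         (sweedler fscale \<Delta> (\<lambda>y c. sweedler fscale \<Delta> (\<lambda>a b. gen (a, b, c)) y) x) =
       coset (relators3 scale)
         (sweedler fscale \<Delta> (\<lambda>a y. sweedler fscale \<Delta> (\<lambda>b c. gen (a, b, c)) y) x)"
    and counit_left: "sweedler scale \<Delta> (\<lambda>a b. scale (\<epsilon> a) b) x = x"
    and counit_right: "sweedler scale \<Delta> (\<lambda>a b. scale (\<epsilon> b) a) x = x"

locale bialgebra = unital_algebra scale \<mu> \<eta> + counital_coalgebra scale \<Delta> \<epsilon>
  for scale :: "'f::field \<Rightarrow> 'a::ab_group_add \<Rightarrow> 'a"
    and \<mu> :: "'a \<Rightarrow> 'a \<Rightarrow> 'a" and \<Delta> :: "'a \<Rightarrow> ('a, 'f) tensor2"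
    and \<eta> :: "'f \<Rightarrow> 'a" and \<epsilon> :: "'a \<Rightarrow> 'f" +
  assumes comult_mult:
      "\<Delta> (\<mu> x y) = coset (relators2 scale)
         (sweedler fscale \<Delta> (\<lambda>a b. sweedler fscale \<Delta> (\<lambda>c d. gen (\<mu> a c, \<mu> b d)) y) x)"
    and comult_one: "\<Delta> (\<eta> 1) = coset (relators2 scale) (gen (\<eta> 1, \<eta> 1))"
    and counit_mult: "\<epsilon> (\<mu> x y) = \<epsilon> x * \<epsilon> y"
    and counit_one: "\<epsilon> (\<eta> 1) = 1"

locale hopf_algebra = bialgebra scale \<mu> \<Delta> \<eta> \<epsilon>
  for scale :: "'f::field \<Rightarrow> 'a::ab_group_add \<Rightarrow> 'a"
    and \<mu> :: "'a \<Rightarrow> 'a \<Rightarrow> 'a" and \<Delta> :: "'a \<Rightarrow> ('a, 'f) tensor2"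
    and \<eta> :: "'f \<Rightarrow> 'a" and \<epsilon> :: "'a \<Rightarrow> 'f" +
  fixes S :: "'a \<Rightarrow> 'a"
  assumes antipode_linear: "Vector_Spaces.linear scale scale S"
    and antipode_left: "sweedler scale \<Delta> (\<lambda>a b. \<mu> (S a) b) x = \<eta> (\<epsilon> x)"
    and antipode_right: "sweedler scale \<Delta> (\<lambda>a b. \<mu> a (S b)) x = \<eta> (\<epsilon> x)"

locale cocommutative_hopf_algebra = hopf_algebra +
  assumes cocommutative:
    "\<Delta> x = coset (relators2 scale) (sweedler fscale \<Delta> (\<lambda>a b. gen (b, a)) x)"

locale coalgebra_map = counital_coalgebra scale \<Delta> \<epsilon>
  for scale :: "'f::field \<Rightarrow> 'a::ab_group_add \<Rightarrow> 'a"
    and \<Delta> :: "'a \<Rightarrow> ('a, 'f) tensor2" and \<epsilon> :: "'a \<Rightarrow> 'f" +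
  fixes B :: "'a \<Rightarrow> 'a"
  assumes map_linear: "Vector_Spaces.linear scale scale B"
    and map_comult:
      "\<Delta> (B x) = coset (relators2 scale) (sweedler fscale \<Delta> (\<lambda>a b. gen (B a, B b)) x)"
    and map_counit: "\<epsilon> (B x) = \<epsilon> x"


section \<open>Rota-Baxter operators\<close>

definition rb_mult ::
  "('f::field \<Rightarrow> 'a::ab_group_add \<Rightarrow> 'a) \<Rightarrow> ('a \<Rightarrow> 'a \<Rightarrow> 'a) \<Rightarrow> ('a \<Rightarrow> ('a, 'f) tensor2) \<Rightarrow>
    ('a \<Rightarrow> 'a) \<Rightarrow> ('a \<Rightarrow> 'a) \<Rightarrow> 'a \<Rightarrow> 'a \<Rightarrow> 'a"
  where "rb_mult scale \<mu> \<Delta> S B x y =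
    sweedler3 scale \<Delta> (\<lambda>a b c. \<mu> (\<mu> (\<mu> a (B b)) y) (S (B c))) x"

definition rb_antipode ::
  "('f::field \<Rightarrow> 'a::ab_group_add \<Rightarrow> 'a) \<Rightarrow> ('a \<Rightarrow> 'a \<Rightarrow> 'a) \<Rightarrow> ('a \<Rightarrow> ('a, 'f) tensor2) \<Rightarrow>
    ('a \<Rightarrow> 'a) \<Rightarrow> ('a \<Rightarrow> 'a) \<Rightarrow> 'a \<Rightarrow> 'a"
  where "rb_antipode scale \<mu> \<Delta> S B x =
    sweedler3 scale \<Delta> (\<lambda>a b c. \<mu> (\<mu> (S (B a)) (S b)) (B c)) x"

locale rota_baxter_operator =
  cocommutative_hopf_algebra scale \<mu> \<Delta> \<eta> \<epsilon> S + coalgebra_map scale \<Delta> \<epsilon> B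
  for scale :: "'f::field \<Rightarrow> 'a::ab_group_add \<Rightarrow> 'a"
    and \<mu> :: "'a \<Rightarrow> 'a \<Rightarrow> 'a" and \<Delta> :: "'a \<Rightarrow> ('a, 'f) tensor2"
    and \<eta> :: "'f \<Rightarrow> 'a" and \<epsilon> :: "'a \<Rightarrow> 'f" and S :: "'a \<Rightarrow> 'a" and B :: "'a \<Rightarrow> 'a" +
  assumes rota_baxter:
    "\<mu> (B x) (B y) = B (sweedler3 scale \<Delta> (\<lambda>a b c. \<mu> (\<mu> (\<mu> a (B b)) y) (S (B c))) x)"

end

(* HOL-Algebra.Group is imported first so that extend means Defs.extend and not the record operation monoid.extend. *)
theory Submission
  imports "HOL-Algebra.Group" Defs
begin

text \<open>
  A cocommutative Hopf algebra is a group object in the category of cocommutative coalgebras: for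
  such a coalgebra \<open>C\<close>, the coalgebra maps \<open>C \<rightarrow> H\<close> form a group under convolution, with inverse
  \<open>f \<mapsto> S \<circ> f\<close>, and \<open>f \<mapsto> B \<circ> f\<close> is a Rota-Baxter operator on this group. On a group with a
  Rota-Baxter operator \<open>b\<close>, the product \<open>x b(x) y b(x)\<^sup>-\<^sup>1\<close> is again a group law, with inverse
  \<open>b(x)\<^sup>-\<^sup>1 x\<^sup>-\<^sup>1 b(x)\<close>. As in the Yoneda lemma, the identities for \<open>H\<^sub>B\<close> follow by applying this to
  the projections of \<open>C = H\<close>, \<open>H \<otimes> H\<close> and \<open>H \<otimes> H \<otimes> H\<close>; that the product is a coalgebra map holds
  because the group is closed under it.
\<close>

section \<open>Linear maps and iterated formal sums\<close>

context vector_space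
begin

lemma extend_linear:
  assumes "Vector_Spaces.linear scale t h"
  shows "h (extend scale f u) = extend t (\<lambda>i. h (f i)) u"
proof -
  interpret h: Vector_Spaces.linear scale t h by (rule assms)
  show ?thesis by (simp add: extend_def h.sum h.scale)
qed

lemma extend_swap:
  "extend scale (\<lambda>i. extend scale (f i) v) u = extend scale (\<lambda>j. extend scale (\<lambda>i. f i j) u) v"
  unfolding extend_def
  by (simp add: scale_sum_right) (subst sum.swap, simp add: mult.commute)

end

section \<open>Coalgebras of parameters\<close>

text \<open>
  A coalgebra \<open>C\<close> that is spanned by the values of a multilinear map on the type \<open>'c\<close>. It is
  only seen through the linear maps \<open>C \<rightarrow> H\<close>: they are the functions \<open>'c \<Rightarrow> 'a\<close> satisfying \<open>L\<close>,
  and \<open>r c\<close> is a formal sum representing \<open>\<Delta> c\<close>. In this way \<open>H \<otimes> H\<close> and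
  \<open>H \<otimes> H \<otimes> H\<close> become coalgebras without being types.
\<close>

locale parameter_coalgebra = vector_space scale
  for scale :: "'f::field \<Rightarrow> 'a::ab_group_add \<Rightarrow> 'a" +
  fixes L :: "('c \<Rightarrow> 'a) \<Rightarrow> bool" and r :: "'c \<Rightarrow> ('c \<times> 'c \<Rightarrow>\<^sub>0 'f)" and e :: "'c \<Rightarrow> 'f"
  assumes L_comp: "\<And>h f. Vector_Spaces.linear scale scale h \<Longrightarrow> L f \<Longrightarrow> L (\<lambda>c. h (f c))"
    and L_zero: "L (\<lambda>c. 0)"
    and L_add: "\<And>f g. L f \<Longrightarrow> L g \<Longrightarrow> L (\<lambda>c. f c + g c)"
    and L_counit: "\<And>v. L (\<lambda>c. scale (e c) v)"
    and L_comult: "\<And>f. (\<And>b. L (\<lambda>a. f a b)) \<Longrightarrow> (\<And>a. L (\<lambda>b. f a b)) \<Longrightarrow>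
      L (\<lambda>c. extend scale (\<lambda>(a, b). f a b) (r c))"
    and L_coassoc: "\<And>f c. (\<And>p q. L (\<lambda>x. f x p q)) \<Longrightarrow> (\<And>p q. L (\<lambda>x. f p x q)) \<Longrightarrow>
      (\<And>p q. L (\<lambda>x. f p q x)) \<Longrightarrow>
      extend scale (\<lambda>(y, z). extend scale (\<lambda>(p, q). f p q z) (r y)) (r c) =
      extend scale (\<lambda>(p, y). extend scale (\<lambda>(q, z). f p q z) (r y)) (r c)"
    and L_cocomm: "\<And>f c. (\<And>b. L (\<lambda>a. f a b)) \<Longrightarrow> (\<And>a. L (\<lambda>b. f a b)) \<Longrightarrow>
      extend scale (\<lambda>(a, b). f b a) (r c) = extend scale (\<lambda>(a, b). f a b) (r c)"
    and L_counital: "\<And>f c. L f \<Longrightarrow> extend scale (\<lambda>(a, b). scale (e a) (f b)) (r c) = f c"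
begin

text \<open>The Sweedler sum of \<open>f\<close> over \<open>r c\<close>. With \<open>c\<close> as
  last argument, \<open>D f\<close> is itself a function of the parameter, so \<open>L\<close> can
  be applied to it.\<close>

definition D :: "('c \<Rightarrow> 'c \<Rightarrow> 'a) \<Rightarrow> 'c \<Rightarrow> 'a"
  where "D f c = extend scale (\<lambda>(a, b). f a b) (r c)"

lemmas L_D = L_comult[folded D_def]
lemmas D_coassoc = L_coassoc[folded D_def]
lemmas D_cocomm = L_cocomm[folded D_def]
lemmas D_counit_left = L_counital[folded D_def]

lemma L_scale: "L f \<Longrightarrow> L (\<lambda>c. scale k (f c))"
  by (rule L_comp) (rule linear_scale_self)

lemma L_sum: "finite I \<Longrightarrow> (\<And>i. i \<in> I \<Longrightarrow> L (f i)) \<Longrightarrow> L (\<lambda>c. \<Sum>i\<in>I. f i c)"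
  by (induction I rule: finite_induct) (auto intro: L_zero L_add)

lemma L_extend: "(\<And>i. L (\<lambda>c. f c i)) \<Longrightarrow> L (\<lambda>c. extend scale (f c) u)"
  unfolding extend_def by (intro L_sum L_scale) auto

lemma L_D_param: "(\<And>a b. L (\<lambda>x. f x a b)) \<Longrightarrow> L (\<lambda>x. D (f x) c)"
  unfolding D_def by (rule L_extend) auto

lemma D_linear: "Vector_Spaces.linear scale scale h \<Longrightarrow> h (D f c) = D (\<lambda>a b. h (f a b)) c"
  unfolding D_def by (simp add: extend_linear case_prod_unfold)

lemma D_scale: "D (\<lambda>a b. scale k (f a b)) c = scale k (D f c)"
  by (rule D_linear[symmetric]) (rule linear_scale_self)

lemma D_swap_extend:
  "D (\<lambda>a b. extend scale (f a b) u) c = extend scale (\<lambda>j. D (\<lambda>a b. f a b j) c) u"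
  unfolding D_def case_prod_unfold by (rule extend_swap)

lemma D_counit_right: "L f \<Longrightarrow> D (\<lambda>a b. scale (e b) (f a)) c = f c"
  by (subst D_cocomm) (simp_all add: D_counit_left L_scale L_counit)

text \<open>Coassociativity groups the four factors as 1, ((2, 3), 4), and cocommutativity then
  exchanges 2 and 3. This is the interchange that makes convolution products of coalgebra maps
  comultiplicative.\<close>

lemma D_middle_four:
  assumes "\<And>q r s. L (\<lambda>x. f x q r s)" "\<And>q r s. L (\<lambda>x. f q x r s)"
    "\<And>q r s. L (\<lambda>x. f q r x s)" "\<And>q r s. L (\<lambda>x. f q r s x)"
  shows "D (\<lambda>a b. D (\<lambda>a1 a2. D (\<lambda>b1 b2. f a1 a2 b1 b2) b) a) c =
    D (\<lambda>a b. D (\<lambda>a1 a2. D (\<lambda>b1 b2. f a1 b1 a2 b2) b) a) c"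
proof -
  \<comment> \<open>The two middle factors are brought under one comultiplication, for
    \<open>f\<close> as well as for \<open>f\<close> with its middle arguments exchanged.\<close>
  have right: "D (\<lambda>a b. D (\<lambda>a1 a2. D (\<lambda>b1 b2. g a1 a2 b1 b2) b) a) c =
      D (\<lambda>a1 y. D (\<lambda>u b2. D (\<lambda>a2 b1. g a1 a2 b1 b2) u) y) c"
    if g: "\<And>q r s. L (\<lambda>x. g x q r s)" "\<And>q r s. L (\<lambda>x. g q x r s)"
    "\<And>q r s. L (\<lambda>x. g q r x s)" "\<And>q r s. L (\<lambda>x. g q r s x)" for g
  proof -
    have "D (\<lambda>a b. D (\<lambda>a1 a2. D (\<lambda>b1 b2. g a1 a2 b1 b2) b) a) c =
        D (\<lambda>a1 y. D (\<lambda>a2 b. D (\<lambda>b1 b2. g a1 a2 b1 b2) b) y) c"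
      by (rule D_coassoc) (intro L_D_param L_D g)+
    also have "\<dots> = D (\<lambda>a1 y. D (\<lambda>u b2. D (\<lambda>a2 b1. g a1 a2 b1 b2) u) y) c"
      by (subst D_coassoc) (intro g refl)+
    finally show ?thesis .
  qed
  have swap: "D (\<lambda>p q. f a p q b) u = D (\<lambda>p q. f a q p b) u" for a b u
    by (rule D_cocomm) (rule assms)+
  show ?thesis
    unfolding right[of f, OF assms] right[of "\<lambda>p q r. f p r q", OF assms(1,3,2,4)] by (simp only: swap)
qed

end


section \<open>Tensor products of parameter coalgebras\<close>

lemma extend_gen_self: "extend fscale gen u = u"
  by (rule poly_mapping_eqI)
    (auto simp: extend_def gen_def lookup_sum lookup_single when_def in_keys_iff
      if_distrib[of "(*) _"] sum.delta cong: if_cong)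

lemma extend_extend_gen:
  "vector_space scale \<Longrightarrow> extend scale g (extend fscale f u) = extend scale (\<lambda>i. extend scale g (f i)) u"
  by (rule formal.extend_linear) (rule vector_space.linear_extend)

text \<open>The comultiplication of a tensor product at an elementary tensor: both factors are split
  and the two middle tensor factors exchanged.\<close>

definition prod_comult ::
  "('c \<Rightarrow> ('c \<times> 'c \<Rightarrow>\<^sub>0 'f::field)) \<Rightarrow> ('d \<Rightarrow> ('d \<times> 'd \<Rightarrow>\<^sub>0 'f)) \<Rightarrow>
    'c \<times> 'd \<Rightarrow> (('c \<times> 'd) \<times> ('c \<times> 'd) \<Rightarrow>\<^sub>0 'f)"
  where "prod_comult r r' = (\<lambda>(c, d).
    extend fscale (\<lambda>(a, b). extend fscale (\<lambda>(p, q). gen ((a, p), (b, q))) (r' d)) (r c))"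

text \<open>By the universal property, linear maps on the tensor product are the functions on pairs
  that are linear in each argument.\<close>

definition prod_linear :: "(('c \<Rightarrow> 'a) \<Rightarrow> bool) \<Rightarrow> (('d \<Rightarrow> 'a) \<Rightarrow> bool) \<Rightarrow> ('c \<times> 'd \<Rightarrow> 'a) \<Rightarrow> bool"
  where "prod_linear L L' f \<longleftrightarrow> (\<forall>d. L (\<lambda>c. f (c, d))) \<and> (\<forall>c. L' (\<lambda>d. f (c, d)))"

locale parameter_coalgebra_pair =
  C: parameter_coalgebra scale L r e + C': parameter_coalgebra scale L' r' e'
  for scale :: "'f::field \<Rightarrow> 'a::ab_group_add \<Rightarrow> 'a"
    and L :: "('c \<Rightarrow> 'a) \<Rightarrow> bool" and r e and L' :: "('d \<Rightarrow> 'a) \<Rightarrow> bool" and r' e'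
begin

lemma prod_D:
  "extend scale (\<lambda>(a, b). f a b) (prod_comult r r' (c, d)) =
    C.D (\<lambda>a b. C'.D (\<lambda>p q. f (a, p) (b, q)) d) c"
  by (simp add: prod_comult_def C.D_def C'.D_def extend_extend_gen[OF C.vector_space_axioms]
      case_prod_unfold)

lemma D_swap: "C.D (\<lambda>a b. C'.D (f a b) d) c = C'.D (\<lambda>p q. C.D (\<lambda>a b. f a b p q) c) d"
  unfolding C'.D_def case_prod_unfold by (rule C.D_swap_extend)

lemma L_D': "(\<And>p q. L (\<lambda>x. f x p q)) \<Longrightarrow> L (\<lambda>x. C'.D (f x) c)"
  unfolding C'.D_def by (rule C.L_extend) auto

lemma L'_D: "(\<And>p q. L' (\<lambda>x. f x p q)) \<Longrightarrow> L' (\<lambda>x. C.D (f x) c)"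
  unfolding C.D_def by (rule C'.L_extend) auto

text \<open>Once all sums over \<open>c\<close> are moved outside those over \<open>d\<close>,
  coassociativity of each factor applies separately.\<close>

lemma prod_coassoc:
  assumes f: "\<And>p q. prod_linear L L' (\<lambda>x. f x p q)" "\<And>p q. prod_linear L L' (\<lambda>x. f p x q)"
    "\<And>p q. prod_linear L L' (\<lambda>x. f p q x)"
  shows "C.D (\<lambda>a b. C'.D (\<lambda>a' b'. C.D (\<lambda>p q. C'.D (\<lambda>p' q'.
      f (p, p') (q, q') (b, b')) a') a) d) c =
    C.D (\<lambda>a b. C'.D (\<lambda>a' b'. C.D (\<lambda>p q. C'.D (\<lambda>p' q'.
      f (a, a') (p, p') (q, q')) b') b) d) c"
    (is "?l = ?r")
proof -
  note [intro] = f[unfolded prod_linear_def, THEN conjunct1, rule_format]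
    f[unfolded prod_linear_def, THEN conjunct2, rule_format]
  have "?l = C.D (\<lambda>a b. C.D (\<lambda>p q. C'.D (\<lambda>a' b'. C'.D (\<lambda>p' q'.
      f (p, p') (q, q') (b, b')) a') d) a) c"
    by (simp only: D_swap[symmetric])
  also have "\<dots> = C.D (\<lambda>a b. C.D (\<lambda>p q. C'.D (\<lambda>a' b'. C'.D (\<lambda>p' q'.
      f (p, a') (q, p') (b, q')) b') d) a) c"
    by (subst C'.D_coassoc) auto
  also have "\<dots> = C.D (\<lambda>a b. C.D (\<lambda>p q. C'.D (\<lambda>a' b'. C'.D (\<lambda>p' q'.
      f (a, a') (p, p') (q, q')) b') d) b) c"
    by (rule C.D_coassoc) (intro L_D' allI; blast)+
  also have "\<dots> = ?r"
    by (simp only: D_swap[symmetric])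
  finally show ?thesis .
qed

text \<open>Applied twice, starting from \<open>H\<close>, this yields \<open>H \<otimes> H\<close>
  and \<open>(H \<otimes> H) \<otimes> H\<close>. After \<open>prod_D\<close> each law is checked
  one factor at a time.\<close>

lemma parameter_coalgebra_prod:
  "parameter_coalgebra scale (prod_linear L L') (prod_comult r r') (\<lambda>(c, d). e c * e' d)"
proof unfold_locales
  fix h and f :: "'c \<times> 'd \<Rightarrow> 'a"
  assume "Vector_Spaces.linear scale scale h" "prod_linear L L' f"
  then show "prod_linear L L' (\<lambda>c. h (f c))"
    unfolding prod_linear_def by (auto intro: C.L_comp C'.L_comp)
next
  show "prod_linear L L' (\<lambda>c. 0)"
    by (simp add: prod_linear_def C.L_zero C'.L_zero)
next
  fix f g :: "'c \<times> 'd \<Rightarrow> 'a"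
  assume "prod_linear L L' f" "prod_linear L L' g"
  then show "prod_linear L L' (\<lambda>c. f c + g c)"
    by (simp add: prod_linear_def C.L_add C'.L_add)
next
  fix v
  have "L (\<lambda>c. scale (e' d) (scale (e c) v))" for d
    by (rule C.L_scale C.L_counit)+
  moreover have "L' (\<lambda>d. scale (e c) (scale (e' d) v))" for c
    by (rule C'.L_scale C'.L_counit)+
  ultimately show "prod_linear L L' (\<lambda>c. scale (case c of (c, d) \<Rightarrow> e c * e' d) v)"
    by (simp add: prod_linear_def mult.commute)
next
  fix f :: "'c \<times> 'd \<Rightarrow> 'c \<times> 'd \<Rightarrow> 'a"
  assume f: "\<And>b. prod_linear L L' (\<lambda>a. f a b)" "\<And>a. prod_linear L L' (\<lambda>b. f a b)"
  note f' = f[unfolded prod_linear_def, THEN conjunct1, rule_format]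
    f[unfolded prod_linear_def, THEN conjunct2, rule_format]
  show "prod_linear L L' (\<lambda>c. extend scale (\<lambda>(a, b). f a b) (prod_comult r r' c))"
    unfolding prod_linear_def prod_D
    by (intro conjI allI C.L_D L_D' C'.L_D L'_D f')
  show "extend scale (\<lambda>(a, b). f b a) (prod_comult r r' c) =
      extend scale (\<lambda>(a, b). f a b) (prod_comult r r' c)" for c
  proof (cases c)
    case (Pair x y)
    have "C'.D (\<lambda>p q. f (b, q) (a, p)) y = C'.D (\<lambda>p q. f (b, p) (a, q)) y" for a b
      by (rule C'.D_cocomm) (rule f')+
    moreover have "C.D (\<lambda>a b. C'.D (\<lambda>p q. f (b, p) (a, q)) y) x =
        C.D (\<lambda>a b. C'.D (\<lambda>p q. f (a, p) (b, q)) y) x"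
      by (rule C.D_cocomm) (intro L_D' f')+
    ultimately show ?thesis by (simp only: Pair prod_D)
  qed
next
  fix f :: "'c \<times> 'd \<Rightarrow> 'c \<times> 'd \<Rightarrow> 'c \<times> 'd \<Rightarrow> 'a" and c
  assume "\<And>p q. prod_linear L L' (\<lambda>x. f x p q)" "\<And>p q. prod_linear L L' (\<lambda>x. f p x q)"
    "\<And>p q. prod_linear L L' (\<lambda>x. f p q x)"
  from prod_coassoc[OF this]
  show "extend scale (\<lambda>(y, z). extend scale (\<lambda>(p, q). f p q z) (prod_comult r r' y))
      (prod_comult r r' c) =
    extend scale (\<lambda>(p, y). extend scale (\<lambda>(q, z). f p q z) (prod_comult r r' y))
      (prod_comult r r' c)"
    by (cases c) (simp only: prod_D)
next
  fix f :: "'c \<times> 'd \<Rightarrow> 'a" and c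
  assume "prod_linear L L' f"
  then have "L (\<lambda>c. f (c, d))" "L' (\<lambda>d. f (c, d))" for c d
    by (auto simp: prod_linear_def)
  then show "extend scale (\<lambda>(a, b). scale (case a of (c, d) \<Rightarrow> e c * e' d) (f b))
      (prod_comult r r' c) = f c"
    by (cases c) (simp add: prod_D C'.D_scale C'.D_counit_left C.D_counit_left flip: C.scale_scale)
qed

end

section \<open>Sweedler calculus\<close>

text \<open>Bilinear maps into any nonzero space separate tensors, so \<open>H\<close> itself can serve as target.\<close>

lemma tensor2_eqI:
  fixes scale :: "'f::field \<Rightarrow> 'a::ab_group_add \<Rightarrow> 'a"
  assumes "vector_space scale" and "w \<noteq> (0::'a)"
    and eq: "\<And>t. bilinear_map scale scale t \<Longrightarrow>
      extend scale (\<lambda>(a, b). t a b) u = extend scale (\<lambda>(a, b). t a b) v"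
  shows "coset (relators2 scale) u = coset (relators2 scale) v"
proof (rule ccontr)
  interpret vector_space scale by fact
  interpret pair: vector_space_pair fscale scale by unfold_locales
  let ?W = "formal.span (relators2 scale)"
  assume "coset (relators2 scale) u \<noteq> coset (relators2 scale) v"
  then have nin: "u - v \<notin> ?W" by (simp add: coset_eq_iff)
  \<comment> \<open>A basis of the span of the relators stays independent when \<open>u - v\<close>
    is added, so a linear map can be prescribed there: zero on the basis, \<open>w\<close> at
    \<open>u - v\<close>.\<close>
  obtain Bs where Bs: "Bs \<subseteq> ?W" "formal.independent Bs" "?W \<subseteq> formal.span Bs"
    using formal.maximal_independent_subset by blast
  then have "formal.span Bs = ?W"
    by (metis formal.span_minimal formal.subspace_span subset_antisym)
  with nin Bs have "formal.independent (insert (u - v) Bs)"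
    by (simp add: formal.independent_insertI)
  from pair.linear_independent_extend[OF this, of "\<lambda>x. if x = u - v then w else 0"]
  obtain g where g: "Vector_Spaces.linear fscale scale g"
    "\<And>x. x \<in> insert (u - v) Bs \<Longrightarrow> g x = (if x = u - v then w else 0)" by blast
  interpret g: Vector_Spaces.linear fscale scale g by (rule g(1))
  have "g x = 0" if "x \<in> ?W" for x
  proof (rule g.eq_0_on_span)
    show "x \<in> formal.span Bs" using that \<open>formal.span Bs = ?W\<close> by simp
    show "g b = 0" if "b \<in> Bs" for b
      using that g(2)[of b] nin Bs(1) by auto
  qed
  then have rel: "g x = 0" if "x \<in> relators2 scale" for x
    using that by (simp add: formal.span_base)
  \<comment> \<open>Vanishing on the four families of relators amounts to bilinearity of
    \<open>g (gen (x, y))\<close> in \<open>x\<close> and \<open>y\<close>.\<close>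
  have "g (gen (x + x', y)) = g (gen (x, y)) + g (gen (x', y))"
    "g (gen (x, y + y')) = g (gen (x, y)) + g (gen (x, y'))"
    "g (gen (scale c x, y)) = scale c (g (gen (x, y)))"
    "g (gen (x, scale c y)) = scale c (g (gen (x, y)))" for x x' y y' c
    using rel[of "gen (x + x', y) - (gen (x, y) + gen (x', y))"]
      rel[of "gen (x, y + y') - (gen (x, y) + gen (x, y'))"]
      rel[of "gen (scale c x, y) - fscale c (gen (x, y))"]
      rel[of "gen (x, scale c y) - fscale c (gen (x, y))"]
    unfolding relators2_def g.diff g.add g.scale by fastforce+
  then have "bilinear_map scale scale (\<lambda>x y. g (gen (x, y)))"
    unfolding bilinear_map_def by (auto intro!: Vector_Spaces.linear.intro simp: module_hom_axioms_def
      vector_space_axioms module_hom_def module_iff_vector_space)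
  from eq[OF this] have "extend scale (\<lambda>i. g (gen i)) u = extend scale (\<lambda>i. g (gen i)) v"
    by (simp add: case_prod_unfold)
  moreover have "extend scale (\<lambda>i. g (gen i)) x = g x" for x
    by (simp add: formal.extend_linear[OF g(1), symmetric] extend_gen_self)
  ultimately have "g (u - v) = 0" by (simp add: g.diff)
  with g(2)[of "u - v"] \<open>w \<noteq> 0\<close> show False by simp
qed


section \<open>Sweedler sums with values in \<open>H\<close>\<close>

context counital_coalgebra
begin

lemma sweedler_linear_right:
  assumes "Vector_Spaces.linear t scale g"
  shows "g (sweedler t \<Delta> f x) = sweedler scale \<Delta> (\<lambda>a b. g (f a b)) x"
proof -
  interpret g: Vector_Spaces.linear t scale g by (rule assms)
  show ?thesis
    by (simp add: sweedler_def g.vs1.extend_linear[OF assms] case_prod_unfold)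
qed

lemma extend_sweedler:
  "extend scale g (sweedler fscale \<Delta> f x) = sweedler scale \<Delta> (\<lambda>a b. extend scale g (f a b)) x"
  by (rule sweedler_linear_right) (rule linear_extend)

text \<open>Sums and multiples of representatives represent \<open>\<Delta>\<close> of the sum or
  multiple, and \<open>sweedler_eq\<close> makes the value independent of the
  representative.\<close>

lemma linear_sweedler:
  assumes "bilinear_map scale scale f"
  shows "Vector_Spaces.linear scale scale (sweedler scale \<Delta> f)"
proof unfold_locales
  have rep: "\<Delta> x = coset (relators2 scale) (rep (\<Delta> x))" for x
    by (simp add: coset_rep comult_in)
  note eq = sweedler_eq[OF assms]
  show "sweedler scale \<Delta> f (x + y) = sweedler scale \<Delta> f x + sweedler scale \<Delta> f y" for x y
  proof -
    have "\<Delta> (x + y) = coset (relators2 scale) (rep (\<Delta> x) + rep (\<Delta> y))"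
      unfolding comult_add by (metis rep coset_add_coset)
    then show ?thesis by (simp add: eq extend_add) (simp add: sweedler_def)
  qed
  show "sweedler scale \<Delta> f (scale k x) = scale k (sweedler scale \<Delta> f x)" for k x
  proof -
    have "\<Delta> (scale k x) = coset (relators2 scale) (fscale k (rep (\<Delta> x)))"
      unfolding comult_scale by (metis rep coset_scale_coset)
    then show ?thesis by (simp add: eq extend_fscale) (simp add: sweedler_def)
  qed
qed

text \<open>The trilinear extension of \<open>f\<close> kills \<open>relators3\<close>, so it can be
  applied to both sides of \<open>coassoc\<close>.\<close>

lemma sweedler_coassoc:
  assumes f: "\<And>p q. Vector_Spaces.linear scale scale (\<lambda>x. f x p q)"
    "\<And>p q. Vector_Spaces.linear scale scale (\<lambda>x. f p x q)"
    "\<And>p q. Vector_Spaces.linear scale scale (\<lambda>x. f p q x)"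
  shows "sweedler scale \<Delta> (\<lambda>y c. sweedler scale \<Delta> (\<lambda>a b. f a b c) y) x =
    sweedler scale \<Delta> (\<lambda>a y. sweedler scale \<Delta> (\<lambda>b c. f a b c) y) x"
proof -
  let ?f = "\<lambda>(a, b, c). f a b c"
  interpret f1: Vector_Spaces.linear scale scale "\<lambda>x. f x p q" for p q by (rule f)
  interpret f2: Vector_Spaces.linear scale scale "\<lambda>x. f p x q" for p q by (rule f)
  interpret f3: Vector_Spaces.linear scale scale "\<lambda>x. f p q x" for p q by (rule f)
  interpret L: Vector_Spaces.linear fscale scale "extend scale ?f" by (rule linear_extend)
  have "extend scale ?f r \<in> {0}" if "r \<in> relators3 scale" for r
    using that unfolding relators3_def
    by (auto simp: L.diff L.add L.scale f1.add f1.scale f2.add f2.scale f3.add f3.scale)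
  from extend_cong_mod[OF _ this coassoc[of x]] show ?thesis
    by (simp add: subspace_single_0 extend_sweedler)
qed

end

context hopf_algebra
begin

lemma bilinear_mapI:
  "(\<And>x. Vector_Spaces.linear scale scale (f x)) \<Longrightarrow>
    (\<And>y. Vector_Spaces.linear scale scale (\<lambda>x. f x y)) \<Longrightarrow> bilinear_map scale scale f"
  by (simp add: bilinear_map_def)

lemma unit_eq: "\<eta> c = scale c (\<eta> 1)"
proof -
  interpret Vector_Spaces.linear "(*)" scale \<eta> by (rule unit_linear)
  show ?thesis using scale[of c 1] by simp
qed

lemma mult_one_left: "\<mu> (\<eta> 1) x = x" and mult_one_right: "\<mu> x (\<eta> 1) = x"
  by (simp_all add: unit_left unit_right)

text \<open>Otherwise \<open>\<epsilon> (\<eta> 1)\<close> would vanish. This makes \<open>H\<close>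
  an admissible target in \<open>tensor2_eqI\<close>, and lets scalars be compared as multiples of
  \<open>\<eta> 1\<close>.\<close>

lemma one_neq_zero: "\<eta> 1 \<noteq> 0"
proof
  interpret Vector_Spaces.linear scale "(*)" \<epsilon> by (rule counit_linear)
  assume "\<eta> 1 = 0"
  then show False using counit_one by (simp add: zero)
qed

lemma linear_mult_left: "Vector_Spaces.linear scale scale (\<mu> x)"
  and linear_mult_right: "Vector_Spaces.linear scale scale (\<lambda>x. \<mu> x y)"
  using mult_bilinear by (simp_all add: bilinear_map_def)

end

section \<open>Sweedler calculus of a cocommutative Hopf algebra; its antipode is a coalgebra
  map\<close>

context cocommutative_hopf_algebra
begin

text \<open>\<open>H\<close> as a coalgebra of parameters over itself. The laws hold because
  multilinear maps do not see which representative of \<open>\<Delta> x\<close> was chosen.\<close>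

sublocale H: parameter_coalgebra scale "Vector_Spaces.linear scale scale" "\<lambda>x. rep (\<Delta> x)" \<epsilon>
proof (intro parameter_coalgebra.intro parameter_coalgebra_axioms.intro vector_space_axioms)
  show "Vector_Spaces.linear scale scale (\<lambda>c. h (f c))"
    if "Vector_Spaces.linear scale scale h" "Vector_Spaces.linear scale scale f" for h f
    using Vector_Spaces.linear_compose[OF that(2,1)] by (simp add: o_def)
  show "Vector_Spaces.linear scale scale (\<lambda>c. 0)"
    by (simp add: Vector_Spaces.linear_iff vector_space_axioms)
  show "Vector_Spaces.linear scale scale (\<lambda>c. f c + g c)"
    if "Vector_Spaces.linear scale scale f" "Vector_Spaces.linear scale scale g" for f g
    using that by (simp add: Vector_Spaces.linear_iff scale_right_distrib ac_simps)
  show "Vector_Spaces.linear scale scale (\<lambda>c. scale (\<epsilon> c) v)" for v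
  proof -
    interpret Vector_Spaces.linear scale "(*)" \<epsilon> by (rule counit_linear)
    show ?thesis
      by unfold_locales (simp_all add: add scale scale_left_distrib)
  qed
  fix f :: "'b \<Rightarrow> 'b \<Rightarrow> 'b"
  assume f: "\<And>b. Vector_Spaces.linear scale scale (\<lambda>a. f a b)"
    "\<And>a. Vector_Spaces.linear scale scale (\<lambda>b. f a b)"
  show "Vector_Spaces.linear scale scale (\<lambda>c. extend scale (\<lambda>(a, b). f a b) (rep (\<Delta> c)))"
    using linear_sweedler[of f] f by (auto simp: bilinear_map_def sweedler_def[abs_def])
  \<comment> \<open>The flipped sum is a second representative of \<open>\<Delta> c\<close>, and
    bilinear \<open>f\<close> takes the same value on both.\<close>
  show "extend scale (\<lambda>(a, b). f b a) (rep (\<Delta> c)) = extend scale (\<lambda>(a, b). f a b) (rep (\<Delta> c))" for c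
    using sweedler_eq[where f = f and t = scale and \<Delta> = \<Delta> and x = c, OF _ cocommutative] bilinear_mapI[of f] f
    by (simp add: extend_sweedler) (simp add: sweedler_def)
next
  fix f :: "'b \<Rightarrow> 'b \<Rightarrow> 'b \<Rightarrow> 'b" and c
  assume "\<And>p q. Vector_Spaces.linear scale scale (\<lambda>x. f x p q)"
    "\<And>p q. Vector_Spaces.linear scale scale (\<lambda>x. f p x q)"
    "\<And>p q. Vector_Spaces.linear scale scale (\<lambda>x. f p q x)"
  from sweedler_coassoc[OF this]
  show "extend scale (\<lambda>(y, z). extend scale (\<lambda>(p, q). f p q z) (rep (\<Delta> y))) (rep (\<Delta> c)) =
      extend scale (\<lambda>(p, y). extend scale (\<lambda>(q, z). f p q z) (rep (\<Delta> y))) (rep (\<Delta> c))"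
    by (simp add: sweedler_def)
next
  fix f :: "'b \<Rightarrow> 'b" and c
  assume f: "Vector_Spaces.linear scale scale f"
  interpret Vector_Spaces.linear scale scale f by (rule f)
  show "extend scale (\<lambda>(a, b). scale (\<epsilon> a) (f b)) (rep (\<Delta> c)) = f c"
    using sweedler_linear_right[OF f, of "\<lambda>a b. scale (\<epsilon> a) b" c]
    by (simp add: counit_left scale) (simp add: sweedler_def)
qed

lemma sweedler_eq_D: "sweedler scale \<Delta> f x = H.D f x"
  by (simp add: sweedler_def H.D_def)

lemma tensor2_D:
  "bilinear_map scale scale t \<Longrightarrow> \<Delta> x = coset (relators2 scale) u \<Longrightarrow>
    H.D t x = extend scale (\<lambda>(a, b). t a b) u"
  unfolding sweedler_eq_D[symmetric] by (rule sweedler_eq)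

lemma D_mult:
  "bilinear_map scale scale t \<Longrightarrow>
    H.D t (\<mu> x y) = H.D (\<lambda>a b. H.D (\<lambda>c d. t (\<mu> a c) (\<mu> b d)) y) x"
  by (simp add: tensor2_D[OF _ comult_mult] extend_sweedler sweedler_eq_D)

lemma D_one: "bilinear_map scale scale t \<Longrightarrow> H.D t (\<eta> 1) = t (\<eta> 1) (\<eta> 1)"
  by (simp add: tensor2_D[OF _ comult_one])

lemma D_antipode_right: "H.D (\<lambda>a b. \<mu> a (S b)) x = scale (\<epsilon> x) (\<eta> 1)"
  using antipode_right[of x] by (simp add: sweedler_eq_D unit_eq[of "\<epsilon> x"])

lemma D_antipode_left: "H.D (\<lambda>a b. \<mu> (S a) b) x = scale (\<epsilon> x) (\<eta> 1)"
  using antipode_left[of x] by (simp add: sweedler_eq_D unit_eq[of "\<epsilon> x"])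

lemma lin_scale: "Vector_Spaces.linear scale scale f \<Longrightarrow> f (scale k x) = scale k (f x)"
  by (simp add: Vector_Spaces.linear_iff)

lemma lin_id: "Vector_Spaces.linear scale scale (\<lambda>x. x)"
  by (rule linear_ident)

lemma lin_const_mult: "Vector_Spaces.linear scale scale f \<Longrightarrow> Vector_Spaces.linear scale scale (\<lambda>x. \<mu> y (f x))"
  and lin_mult_const: "Vector_Spaces.linear scale scale f \<Longrightarrow> Vector_Spaces.linear scale scale (\<lambda>x. \<mu> (f x) y)"
  and lin_antipode: "Vector_Spaces.linear scale scale f \<Longrightarrow> Vector_Spaces.linear scale scale (\<lambda>x. S (f x))"
  by (rule H.L_comp[OF linear_mult_left] H.L_comp[OF linear_mult_right] H.L_comp[OF antipode_linear],
      assumption)+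

lemmas lin_intros = lin_id lin_const_mult lin_mult_const lin_antipode H.L_scale H.L_counit
  H.L_D H.L_D_param

lemma bilinear_map_apply:
  assumes "bilinear_map scale scale t" "Vector_Spaces.linear scale scale f"
  shows "Vector_Spaces.linear scale scale (\<lambda>x. t (f x) y)" "Vector_Spaces.linear scale scale (\<lambda>x. t y (f x))"
  using assms(1) H.L_comp[OF _ assms(2)] by (auto simp: bilinear_map_def)

text \<open>In the convolution algebra of linear maps \<open>H \<rightarrow> H \<otimes> H\<close> both \<open>\<Delta> \<circ> S\<close> and
  \<open>(S \<otimes> S) \<circ> \<Delta>\<close> are inverse to \<open>\<Delta>\<close>.\<close>

lemma D_comult_antipode:
  assumes t: "bilinear_map scale scale t"
  shows "H.D (\<lambda>b z. H.D (\<lambda>b1 b2. H.D (\<lambda>z1 z2. t (\<mu> (\<mu> p b1) (S z1)) (\<mu> (\<mu> q b2) (S z2))) z) b) y =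
    scale (\<epsilon> y) (t p q)"
proof -
  note lin = bilinear_map_apply[OF t] lin_intros
  \<comment> \<open>The antipode law in a single tensor factor, multiplied on the left by
    \<open>p\<close> and fed to a linear map.\<close>
  have inv: "H.D (\<lambda>b1 b2. g (\<mu> (\<mu> p b1) (S b2))) b = scale (\<epsilon> b) (g p)"
    if "Vector_Spaces.linear scale scale g" for g p b
  proof -
    have "Vector_Spaces.linear scale scale (\<lambda>x. g (\<mu> p x))"
      by (rule H.L_comp[OF that]) (intro lin_intros)
    from H.D_linear[OF this, of "\<lambda>b1 b2. \<mu> b1 (S b2)" b]
      lin_scale[OF this, of "\<epsilon> b" "\<eta> 1"]
    show ?thesis by (simp add: mult_assoc D_antipode_right mult_one_right)
  qed
  \<comment> \<open>The regrouping places each factor next to the antipode that cancels it, so that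
    the two tensor factors can be treated one after the other.\<close>
  have "H.D (\<lambda>b z. H.D (\<lambda>b1 b2. H.D (\<lambda>z1 z2. t (\<mu> (\<mu> p b1) (S z1)) (\<mu> (\<mu> q b2) (S z2))) z) b) y =
    H.D (\<lambda>b z. H.D (\<lambda>b1 b2. H.D (\<lambda>z1 z2. t (\<mu> (\<mu> p b1) (S b2)) (\<mu> (\<mu> q z1) (S z2))) z) b) y"
    by (rule H.D_middle_four) (intro lin)+
  also have "\<dots> = H.D (\<lambda>b z. H.D (\<lambda>b1 b2. scale (\<epsilon> z) (t (\<mu> (\<mu> p b1) (S b2)) q)) b) y"
    by (subst inv[of "t _"]) (intro lin refl)+
  also have "\<dots> = H.D (\<lambda>b z. scale (\<epsilon> b) (scale (\<epsilon> z) (t p q))) y"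
    by (subst inv[of "\<lambda>x. scale _ (t x _)"]) (intro lin refl)+
  also have "\<dots> = scale (\<epsilon> y) (t p q)"
    by (subst H.D_counit_left) (intro lin refl)+
  finally show ?thesis .
qed

text \<open>Uniqueness of convolution inverses, written out: the cancelling product of
  \<open>D_comult_antipode\<close> is inserted after \<open>\<Delta> (S a)\<close>, and
  reassociating cancels \<open>S a\<close> against \<open>b\<close> instead.\<close>

lemma antipode_comult:
  assumes t: "bilinear_map scale scale t"
  shows "H.D t (S x) = H.D (\<lambda>a b. t (S a) (S b)) x"
proof -
  note lin = bilinear_map_apply[OF t] lin_intros
  \<comment> \<open>\<open>J w z\<close> is \<open>t\<close> applied to the product of
    \<open>\<Delta> w\<close> and \<open>(S \<otimes> S) (\<Delta> z)\<close>; being linear in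
    \<open>w\<close>, it can absorb \<open>\<mu> (S a) b\<close>.\<close>
  define J where "J w z = H.D (\<lambda>r s. H.D (\<lambda>z1 z2. t (\<mu> r (S z1)) (\<mu> s (S z2))) z) w" for w z
  have J1: "Vector_Spaces.linear scale scale (\<lambda>w. J w z)" and J2: "Vector_Spaces.linear scale scale (\<lambda>z. J w z)" for w z
    unfolding J_def by (intro lin)+
  have "H.D t (S x) = H.D (\<lambda>a y. scale (\<epsilon> y) (H.D t (S a))) x"
    by (rule H.D_counit_right[symmetric], rule H.L_comp[OF H.L_D antipode_linear]) (intro lin)+
  also have "\<dots> = H.D (\<lambda>a y. H.D (\<lambda>p q. scale (\<epsilon> y) (t p q)) (S a)) x"
    by (simp only: H.D_scale)
  also have "\<dots> = H.D (\<lambda>a y. H.D (\<lambda>p q. H.D (\<lambda>b z. H.D (\<lambda>b1 b2.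
      H.D (\<lambda>z1 z2. t (\<mu> (\<mu> p b1) (S z1)) (\<mu> (\<mu> q b2) (S z2))) z) b) y) (S a)) x"
    by (simp only: D_comult_antipode[OF t])
  also have "\<dots> = H.D (\<lambda>a y. H.D (\<lambda>b z. H.D (\<lambda>p q. H.D (\<lambda>b1 b2.
      H.D (\<lambda>z1 z2. t (\<mu> (\<mu> p b1) (S z1)) (\<mu> (\<mu> q b2) (S z2))) z) b) (S a)) y) x"
    unfolding H.D_def[of _ "S _"] H.D_swap_extend[symmetric] case_prod_unfold ..
  also have "\<dots> = H.D (\<lambda>a y. H.D (\<lambda>b z. J (\<mu> (S a) b) z) y) x"
    unfolding J_def by (subst D_mult) (intro bilinear_mapI lin refl)+
  also have "\<dots> = H.D (\<lambda>u z. H.D (\<lambda>a b. J (\<mu> (S a) b) z) u) x"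
    by (rule H.D_coassoc[symmetric]) (intro J2 H.L_comp[OF J1] lin)+
  also have "\<dots> = H.D (\<lambda>u z. scale (\<epsilon> u) (J (\<eta> 1) z)) x"
    by (simp only: H.D_linear[OF J1, symmetric] D_antipode_left lin_scale[OF J1])
  also have "\<dots> = J (\<eta> 1) x"
    by (rule H.D_counit_left) (rule J2)
  also have "\<dots> = H.D (\<lambda>a b. t (S a) (S b)) x"
    unfolding J_def by (subst D_one) (simp_all add: mult_one_left, intro bilinear_mapI lin)
  finally show ?thesis .
qed

text \<open>Combine the counit law, multiplicativity of \<open>\<epsilon>\<close> and the antipode
  law. Scalars are carried as multiples of \<open>\<eta> 1\<close> because \<open>H.D\<close> takes
  values in \<open>H\<close>.\<close>

lemma antipode_counit: "\<epsilon> (S x) = \<epsilon> x"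
proof -
  interpret \<epsilon>: Vector_Spaces.linear scale "(*)" \<epsilon> by (rule counit_linear)
  interpret S: Vector_Spaces.linear scale scale S by (rule antipode_linear)
  have "scale (\<epsilon> (S x)) (\<eta> 1) = scale (\<epsilon> (S (H.D (\<lambda>a b. scale (\<epsilon> b) a) x))) (\<eta> 1)"
    by (simp add: H.D_counit_right[OF lin_id])
  also have "\<dots> = H.D (\<lambda>a b. scale (\<epsilon> (\<mu> (S a) b)) (\<eta> 1)) x"
    using H.D_linear[of "\<lambda>x. scale (\<epsilon> (S x)) (\<eta> 1)" "\<lambda>a b. scale (\<epsilon> b) a" x]
      H.L_comp[OF H.L_counit antipode_linear]
    by (simp add: S.scale \<epsilon>.scale counit_mult mult.commute)
  also have "\<dots> = scale (\<epsilon> (H.D (\<lambda>a b. \<mu> (S a) b) x)) (\<eta> 1)"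
    using H.D_linear[OF H.L_counit[of "\<eta> 1"]] by simp
  also have "\<dots> = scale (\<epsilon> x) (\<eta> 1)"
    by (simp add: D_antipode_left \<epsilon>.scale counit_one)
  finally show ?thesis using one_neq_zero by simp
qed

end

section \<open>The convolution group of coalgebra maps\<close>

locale hopf_points =
  cocommutative_hopf_algebra scale \<mu> \<Delta> \<eta> \<epsilon> S + C: parameter_coalgebra scale L r e
  for scale :: "'f::field \<Rightarrow> 'a::ab_group_add \<Rightarrow> 'a" and \<mu> \<Delta> \<eta> \<epsilon> S
    and L :: "('c \<Rightarrow> 'a) \<Rightarrow> bool" and r e
begin

text \<open>Comultiplicativity is expressed through bilinear maps into \<open>H\<close>, which
  separate tensors by \<open>tensor2_eqI\<close>; in this form it involves only maps from parameters
  to \<open>H\<close>.\<close>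

definition coalgebra_point :: "('c \<Rightarrow> 'a) \<Rightarrow> bool"
  where "coalgebra_point f \<longleftrightarrow> L f \<and> (\<forall>c. \<epsilon> (f c) = e c) \<and>
    (\<forall>t c. bilinear_map scale scale t \<longrightarrow> H.D t (f c) = C.D (\<lambda>a b. t (f a) (f b)) c)"

definition points :: "('c \<Rightarrow> 'a) monoid"
  where "points = \<lparr>carrier = Collect coalgebra_point,
    monoid.mult = (\<lambda>f g. C.D (\<lambda>a b. \<mu> (f a) (g b))), one = (\<lambda>c. scale (e c) (\<eta> 1))\<rparr>"

lemma mult_points: "f \<otimes>\<^bsub>points\<^esub> g = C.D (\<lambda>a b. \<mu> (f a) (g b))"
  and one_points: "\<one>\<^bsub>points\<^esub> = (\<lambda>c. scale (e c) (\<eta> 1))"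
  and carrier_points: "f \<in> carrier points \<longleftrightarrow> coalgebra_point f"
  by (simp_all add: points_def)

lemma point_L: "coalgebra_point f \<Longrightarrow> L f"
  and point_counit: "coalgebra_point f \<Longrightarrow> \<epsilon> (f c) = e c"
  and point_comult: "coalgebra_point f \<Longrightarrow> bilinear_map scale scale t \<Longrightarrow>
    H.D t (f c) = C.D (\<lambda>a b. t (f a) (f b)) c"
  by (simp_all add: coalgebra_point_def)

lemma L_const_mult: "L f \<Longrightarrow> L (\<lambda>x. \<mu> y (f x))"
  and L_mult_const: "L f \<Longrightarrow> L (\<lambda>x. \<mu> (f x) y)"
  and L_antipode: "L f \<Longrightarrow> L (\<lambda>x. S (f x))"
  by (rule C.L_comp[OF linear_mult_left] C.L_comp[OF linear_mult_right] C.L_comp[OF antipode_linear],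
      assumption)+

lemmas L_intros = L_const_mult L_mult_const L_antipode C.L_scale C.L_counit C.L_D C.L_D_param

lemma bilinear_map_L:
  assumes "bilinear_map scale scale t" "L f"
  shows "L (\<lambda>x. t (f x) y)" "L (\<lambda>x. t y (f x))"
  using assms(1) C.L_comp[OF _ assms(2)] by (auto simp: bilinear_map_def)

lemma bilinear_map_scale:
  assumes "bilinear_map scale scale t"
  shows "t (scale k x) y = scale k (t x y)" "t x (scale k y) = scale k (t x y)"
  using assms lin_scale[of "t x"] lin_scale[of "\<lambda>x. t x y"] by (auto simp: bilinear_map_def)

text \<open>The product of \<open>H\<close>, \<open>f\<close> and \<open>g\<close> all respect
  comultiplication; what remains is to exchange the two middle factors of \<open>c\<close>, and here
  cocommutativity enters.\<close>

lemma point_mult: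
  assumes f: "coalgebra_point f" and g: "coalgebra_point g"
  shows "coalgebra_point (C.D (\<lambda>a b. \<mu> (f a) (g b)))"
  unfolding coalgebra_point_def
proof (intro conjI allI impI)
  show "L (C.D (\<lambda>a b. \<mu> (f a) (g b)))"
    by (intro L_intros point_L f g)
next
  fix c
  have "scale (\<epsilon> (C.D (\<lambda>a b. \<mu> (f a) (g b)) c)) (\<eta> 1) =
      C.D (\<lambda>a b. scale (e a) (scale (e b) (\<eta> 1))) c"
    using C.D_linear[OF H.L_counit[of "\<eta> 1"]] by (simp add: counit_mult point_counit f g)
  also have "\<dots> = scale (e c) (\<eta> 1)"
    by (rule C.D_counit_left) (rule C.L_counit)
  finally show "\<epsilon> (C.D (\<lambda>a b. \<mu> (f a) (g b)) c) = e c"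
    using one_neq_zero by simp
next
  fix t c
  assume t: "bilinear_map scale scale t"
  have t': "Vector_Spaces.linear scale scale (t x)" "Vector_Spaces.linear scale scale (\<lambda>x. t x y)" for x y
    using t by (simp_all add: bilinear_map_def)
  note lin = bilinear_mapI bilinear_map_apply[OF t] lin_intros
  note L = bilinear_map_L[OF t] L_intros point_L[OF f] point_L[OF g]
  have "H.D t (C.D (\<lambda>a b. \<mu> (f a) (g b)) c) = C.D (\<lambda>a b. H.D t (\<mu> (f a) (g b))) c"
    by (rule C.D_linear) (intro H.L_D t')
  also have "\<dots> = C.D (\<lambda>a b. H.D (\<lambda>p q. H.D (\<lambda>r s. t (\<mu> p r) (\<mu> q s)) (g b)) (f a)) c"
    by (simp only: D_mult[OF t])
  also have "\<dots> = C.D (\<lambda>a b. C.D (\<lambda>a1 a2. H.D (\<lambda>r s. t (\<mu> (f a1) r) (\<mu> (f a2) s)) (g b)) a) c"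
    by (subst point_comult[OF f]) (intro lin refl)+
  also have "\<dots> = C.D (\<lambda>a b. C.D (\<lambda>a1 a2. C.D (\<lambda>b1 b2.
      t (\<mu> (f a1) (g b1)) (\<mu> (f a2) (g b2))) b) a) c"
    by (subst point_comult[OF g]) (intro lin refl)+
  also have "\<dots> = C.D (\<lambda>a b. C.D (\<lambda>a1 a2. C.D (\<lambda>b1 b2.
      t (\<mu> (f a1) (g a2)) (\<mu> (f b1) (g b2))) b) a) c"
    by (rule C.D_middle_four) (intro L)+
  also have "\<dots> = C.D (\<lambda>a b. t (C.D (\<lambda>a b. \<mu> (f a) (g b)) a) (C.D (\<lambda>a b. \<mu> (f a) (g b)) b)) c"
    unfolding C.D_linear[OF t'(2)] unfolding C.D_linear[OF t'(1)] ..
  finally show "H.D t (C.D (\<lambda>a b. \<mu> (f a) (g b)) c) =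
    C.D (\<lambda>a b. t (C.D (\<lambda>a b. \<mu> (f a) (g b)) a) (C.D (\<lambda>a b. \<mu> (f a) (g b)) b)) c" .
qed

lemma point_one: "coalgebra_point (\<lambda>c. scale (e c) (\<eta> 1))"
  unfolding coalgebra_point_def
proof (intro conjI allI impI)
  interpret \<epsilon>: Vector_Spaces.linear scale "(*)" \<epsilon> by (rule counit_linear)
  show "\<epsilon> (scale (e c) (\<eta> 1)) = e c" for c
    by (simp add: \<epsilon>.scale counit_one)
  fix t c
  assume t: "bilinear_map scale scale t"
  have "Vector_Spaces.linear scale scale (H.D t)"
    using t by (intro H.L_D) (simp_all add: bilinear_map_def)
  then have "H.D t (scale (e c) (\<eta> 1)) = scale (e c) (t (\<eta> 1) (\<eta> 1))"
    by (simp add: lin_scale D_one t)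
  also have "\<dots> = C.D (\<lambda>a b. scale (e b) (scale (e a) (t (\<eta> 1) (\<eta> 1)))) c"
    by (rule C.D_counit_right[symmetric]) (rule C.L_counit)
  finally show "H.D t (scale (e c) (\<eta> 1)) = C.D (\<lambda>a b. t (scale (e a) (\<eta> 1)) (scale (e b) (\<eta> 1))) c"
    by (simp only: bilinear_map_scale[OF t])
qed (rule C.L_counit)

text \<open>Stated for a general coalgebra endomorphism \<open>h\<close> of \<open>H\<close> in
  order to serve both \<open>S\<close> and \<open>B\<close>.\<close>

lemma point_compose:
  assumes f: "coalgebra_point f" and h: "Vector_Spaces.linear scale scale h" "\<And>x. \<epsilon> (h x) = \<epsilon> x"
    "\<And>t x. bilinear_map scale scale t \<Longrightarrow> H.D t (h x) = H.D (\<lambda>a b. t (h a) (h b)) x"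
  shows "coalgebra_point (\<lambda>c. h (f c))"
  unfolding coalgebra_point_def
proof (intro conjI allI impI)
  show "L (\<lambda>c. h (f c))"
    by (rule C.L_comp) (intro h(1) point_L f)+
  show "\<epsilon> (h (f c)) = e c" for c
    by (simp add: h(2) point_counit f)
  fix t c
  assume t: "bilinear_map scale scale t"
  have "bilinear_map scale scale (\<lambda>a b. t (h a) (h b))"
    by (intro bilinear_mapI bilinear_map_apply[OF t] h(1))
  then show "H.D t (h (f c)) = C.D (\<lambda>a b. t (h (f a)) (h (f b))) c"
    by (simp add: h(3)[OF t] point_comult[OF f])
qed

lemma point_antipode: "coalgebra_point f \<Longrightarrow> coalgebra_point (\<lambda>c. S (f c))"
  by (rule point_compose) (auto intro: antipode_linear antipode_counit antipode_comult)

text \<open>As \<open>f\<close> respects comultiplication, this is the antipode law of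
  \<open>H\<close> at \<open>f c\<close>.\<close>

lemma mult_antipode_left:
  assumes "coalgebra_point f"
  shows "C.D (\<lambda>a b. \<mu> (S (f a)) (f b)) c = scale (e c) (\<eta> 1)"
  using point_comult[OF assms, of "\<lambda>p q. \<mu> (S p) q" c]
  by (simp add: bilinear_mapI lin_intros D_antipode_left point_counit[OF assms])

lemma group_points: "group points"
proof (rule groupI; unfold carrier_points mult_points one_points)
  fix f g h
  assume f: "coalgebra_point f" and g: "coalgebra_point g" and h: "coalgebra_point h"
  show "C.D (\<lambda>a b. \<mu> (C.D (\<lambda>a b. \<mu> (f a) (g b)) a) (h b)) = C.D (\<lambda>a b. \<mu> (f a) (C.D (\<lambda>a b. \<mu> (g a) (h b)) b))"
    unfolding C.D_linear[OF linear_mult_left] C.D_linear[OF linear_mult_right] mult_assoc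
    by (rule ext) (rule C.D_coassoc; intro L_intros point_L f g h)
next
  fix f assume f: "coalgebra_point f"
  show "C.D (\<lambda>a b. \<mu> (scale (e a) (\<eta> 1)) (f b)) = f"
    by (simp add: lin_scale[OF linear_mult_right] mult_one_left C.D_counit_left point_L f fun_eq_iff)
  show "\<exists>g\<in>carrier points. C.D (\<lambda>a b. \<mu> (g a) (f b)) = (\<lambda>c. scale (e c) (\<eta> 1))"
    by (rule bexI[of _ "\<lambda>c. S (f c)"])
      (simp_all add: carrier_points point_antipode f mult_antipode_left fun_eq_iff)
qed (rule point_mult point_one; assumption)+

sublocale G: group points
  by (rule group_points)

lemma inv_points: "coalgebra_point f \<Longrightarrow> inv\<^bsub>points\<^esub> f = (\<lambda>c. S (f c))"
  by (rule G.inv_equality)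
    (simp_all add: carrier_points point_antipode mult_points one_points mult_antipode_left fun_eq_iff)

end

section \<open>Rota-Baxter groups\<close>

locale rota_baxter_group = group G for G :: "('g, 'm) monoid_scheme" (structure) +
  fixes b :: "'g \<Rightarrow> 'g"
  assumes b_closed [simp]: "x \<in> carrier G \<Longrightarrow> b x \<in> carrier G"
    and b_mult: "x \<in> carrier G \<Longrightarrow> y \<in> carrier G \<Longrightarrow> b x \<otimes> b y = b (x \<otimes> b x \<otimes> y \<otimes> inv (b x))"
begin

definition rb :: "'g \<Rightarrow> 'g \<Rightarrow> 'g"
  where "rb x y = x \<otimes> b x \<otimes> y \<otimes> inv (b x)"

lemma rb_closed [simp]: "x \<in> carrier G \<Longrightarrow> y \<in> carrier G \<Longrightarrow> rb x y \<in> carrier G"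
  by (simp add: rb_def)

lemma b_rb: "x \<in> carrier G \<Longrightarrow> y \<in> carrier G \<Longrightarrow> b (rb x y) = b x \<otimes> b y"
  by (simp add: rb_def b_mult)

lemma inv_cancel: "x \<in> carrier G \<Longrightarrow> y \<in> carrier G \<Longrightarrow> inv x \<otimes> (x \<otimes> y) = y"
  "x \<in> carrier G \<Longrightarrow> y \<in> carrier G \<Longrightarrow> x \<otimes> (inv x \<otimes> y) = y"
  by (simp_all flip: m_assoc)

text \<open>By \<open>b_rb\<close>, \<open>b\<close> turns \<open>rb\<close> into the group product,
  so both sides expand to \<open>x (b x) y (b y) z (b y)\<^sup>-\<^sup>1 (b
  x)\<^sup>-\<^sup>1\<close>.\<close>

lemma rb_assoc:
  "x \<in> carrier G \<Longrightarrow> y \<in> carrier G \<Longrightarrow> z \<in> carrier G \<Longrightarrow> rb (rb x y) z = rb x (rb y z)"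
  unfolding rb_def[of "rb x y"] by (simp add: b_rb) (simp add: rb_def m_assoc inv_mult_group inv_cancel)

text \<open>At \<open>x = y = \<one>\<close> the Rota-Baxter identity reads
  \<open>b \<one> \<otimes> b \<one> = b \<one>\<close>; cancel.\<close>

lemma b_one: "b \<one> = \<one>"
  using b_mult[of \<one> \<one>] by (simp add: l_cancel_one)

lemma rb_one_left: "x \<in> carrier G \<Longrightarrow> rb \<one> x = x"
  and rb_one_right: "x \<in> carrier G \<Longrightarrow> rb x \<one> = x"
  by (simp_all add: rb_def b_one m_assoc)

definition rb_inv :: "'g \<Rightarrow> 'g"
  where "rb_inv x = inv (b x) \<otimes> inv x \<otimes> b x"

lemma rb_inv_right: "x \<in> carrier G \<Longrightarrow> rb x (rb_inv x) = \<one>"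
  by (simp add: rb_def rb_inv_def m_assoc inv_cancel)

lemma rb_inv_left:
  assumes x: "x \<in> carrier G"
  shows "rb (rb_inv x) x = \<one>"
proof -
  have x': "rb_inv x \<in> carrier G" using x by (simp add: rb_inv_def)
  \<comment> \<open>The right inverse law is pushed through \<open>b\<close>; it determines
    \<open>b (rb_inv x)\<close>, the one unknown in the left inverse law.\<close>
  have "b x \<otimes> b (rb_inv x) = \<one>"
    using x x' by (simp add: rb_inv_right b_one flip: b_rb)
  then have "b (rb_inv x) = inv (b x)"
    using x x' by (intro inv_equality[symmetric]) (auto dest: inv_comm)
  then show ?thesis
    using x by (simp add: rb_def) (simp add: rb_inv_def m_assoc inv_cancel)
qed

end

section \<open>Points of tensor products\<close>

locale hopf_points_pair =
  C: hopf_points scale \<mu> \<Delta> \<eta> \<epsilon> S L r e + C': hopf_points scale \<mu> \<Delta> \<eta> \<epsilon> S L' r' e'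
  for scale :: "'f::field \<Rightarrow> 'a::ab_group_add \<Rightarrow> 'a" and \<mu> \<Delta> \<eta> \<epsilon> S
    and L :: "('c \<Rightarrow> 'a) \<Rightarrow> bool" and r e and L' :: "('d \<Rightarrow> 'a) \<Rightarrow> bool" and r' e'
begin

sublocale parameter_coalgebra_pair scale L r e L' r' e'
  by unfold_locales

sublocale P: hopf_points scale \<mu> \<Delta> \<eta> \<epsilon> S "prod_linear L L'" "prod_comult r r'" "\<lambda>(c, d). e c * e' d"
  by (intro hopf_points.intro parameter_coalgebra_prod C.cocommutative_hopf_algebra_axioms)

lemma P_D: "P.C.D f (c, d) = C.C.D (\<lambda>a b. C'.C.D (\<lambda>p q. f (a, p) (b, q)) d) c"
  unfolding P.C.D_def by (rule prod_D)

text \<open>The pullback along the projection \<open>id \<otimes> \<epsilon>\<close> onto the first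
  factor; \<open>right\<close> is its mirror image.\<close>

definition left :: "('c \<Rightarrow> 'a) \<Rightarrow> 'c \<times> 'd \<Rightarrow> 'a"
  where "left f = (\<lambda>(c, d). scale (e' d) (f c))"

definition right :: "('d \<Rightarrow> 'a) \<Rightarrow> 'c \<times> 'd \<Rightarrow> 'a"
  where "right f = (\<lambda>(c, d). scale (e c) (f d))"

lemma counit_scale: "\<epsilon> (scale k x) = k * \<epsilon> x"
  using C.counit_linear by (simp add: Vector_Spaces.linear_iff)

lemma linear_D: "bilinear_map scale scale t \<Longrightarrow> Vector_Spaces.linear scale scale (C.H.D t)"
  by (intro C.H.L_D) (simp_all add: bilinear_map_def)

text \<open>The two counits on the side of \<open>d\<close> collapse to one by the counit law, which
  leaves comultiplicativity of \<open>f\<close>.\<close>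

lemma point_left:
  assumes f: "C.coalgebra_point f"
  shows "P.coalgebra_point (left f)"
  unfolding P.coalgebra_point_def
proof (intro conjI allI impI)
  show "prod_linear L L' (left f)"
    by (simp add: prod_linear_def left_def C.C.L_scale C.point_L[OF f] C'.C.L_counit)
  show "\<epsilon> (left f c) = (case c of (c, d) \<Rightarrow> e c * e' d)" for c
    by (cases c) (simp add: left_def counit_scale C.point_counit[OF f])
  fix t and x :: "'c \<times> 'd"
  assume t: "bilinear_map scale scale t"
  obtain c d where x: "x = (c, d)" by (cases x)
  have "C'.C.D (\<lambda>p q. t (scale (e' p) y) (scale (e' q) z)) d = scale (e' d) (t y z)" for y z
    unfolding C.bilinear_map_scale[OF t]
    by (rule C'.C.D_counit_right) (rule C'.C.L_counit)
  then show "C.H.D t (left f x) = P.C.D (\<lambda>a b. t (left f a) (left f b)) x"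
    by (simp add: x P_D left_def C.C.D_scale C.lin_scale[OF linear_D[OF t]] C.point_comult[OF f t])
qed

lemma point_right:
  assumes f: "C'.coalgebra_point f"
  shows "P.coalgebra_point (right f)"
  unfolding P.coalgebra_point_def
proof (intro conjI allI impI)
  show "prod_linear L L' (right f)"
    by (simp add: prod_linear_def right_def C'.C.L_scale C'.point_L[OF f] C.C.L_counit)
  show "\<epsilon> (right f c) = (case c of (c, d) \<Rightarrow> e c * e' d)" for c
    by (cases c) (simp add: right_def counit_scale C'.point_counit[OF f])
  fix t and x :: "'c \<times> 'd"
  assume t: "bilinear_map scale scale t"
  obtain c d where x: "x = (c, d)" by (cases x)
  have "C.C.D (\<lambda>a b. t (scale (e a) y) (scale (e b) z)) c = scale (e c) (t y z)" for y z
    unfolding C.bilinear_map_scale[OF t]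
    by (rule C.C.D_counit_right) (rule C.C.L_counit)
  then show "C.H.D t (right f x) = P.C.D (\<lambda>a b. t (right f a) (right f b)) x"
    by (simp add: x P_D D_swap right_def C'.C.D_scale C.lin_scale[OF linear_D[OF t]] C'.point_comult[OF f t])
qed

lemma D_left:
  assumes t: "bilinear_map scale scale t" and g: "prod_linear L L' g"
  shows "P.C.D (\<lambda>a b. t (left f a) (g b)) (c, d) = C.C.D (\<lambda>a b. t (f a) (g (b, d))) c"
proof -
  have "L' (\<lambda>q. g (b, q))" for b using g by (simp add: prod_linear_def)
  from C'.bilinear_map_L(2)[OF t this]
  show ?thesis
    by (simp add: P_D left_def C.bilinear_map_scale(1)[OF t] C'.C.D_counit_left)
qed

text \<open>Evaluating at elementary tensors in this way turns identities between points into
  identities between elements.\<close>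

lemma D_left_right:
  assumes t: "bilinear_map scale scale t" and f: "L f" and g: "C'.coalgebra_point g"
  shows "P.C.D (\<lambda>a b. t (left f a) (right g b)) (c, d) = t (f c) (g d)"
  using C.bilinear_map_L(1)[OF t f]
  by (simp add: D_left[OF t P.point_L[OF point_right[OF g]]])
    (simp add: right_def C.bilinear_map_scale(2)[OF t] C.C.D_counit_right)

end

section \<open>Rota-Baxter operators on points\<close>

locale rb_points =
  rota_baxter_operator scale \<mu> \<Delta> \<eta> \<epsilon> S B + hopf_points scale \<mu> \<Delta> \<eta> \<epsilon> S L r e
  for scale :: "'f::field \<Rightarrow> 'a::ab_group_add \<Rightarrow> 'a" and \<mu> \<Delta> \<eta> \<epsilon> S B
    and L :: "('c \<Rightarrow> 'a) \<Rightarrow> bool" and r e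

context rota_baxter_operator
begin

lemma lin_map: "Vector_Spaces.linear scale scale f \<Longrightarrow> Vector_Spaces.linear scale scale (\<lambda>x. B (f x))"
  by (rule H.L_comp[OF map_linear])

lemma D_map: "bilinear_map scale scale t \<Longrightarrow> H.D t (B x) = H.D (\<lambda>a b. t (B a) (B b)) x"
  by (simp add: tensor2_D[OF _ map_comult] extend_sweedler sweedler_eq_D)

abbreviation rbm where "rbm \<equiv> rb_mult scale \<mu> \<Delta> S B"

lemma rbm_eq: "rbm x y = H.D (\<lambda>u c. H.D (\<lambda>a b. \<mu> (\<mu> (\<mu> a (B b)) y) (S (B c))) u) x"
  by (simp add: rb_mult_def sweedler3_def sweedler_eq_D)

lemma bilinear_rbm: "bilinear_map scale scale rbm"
  unfolding rbm_eq[abs_def] by (intro bilinear_mapI lin_intros lin_map)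

lemma map_rbm: "B (rbm x y) = \<mu> (B x) (B y)"
  unfolding rb_mult_def by (rule rota_baxter[symmetric])

end

context rb_points
begin

lemma L_map: "L f \<Longrightarrow> L (\<lambda>x. B (f x))"
  by (rule C.L_comp[OF map_linear])

lemma point_map: "coalgebra_point f \<Longrightarrow> coalgebra_point (\<lambda>c. B (f c))"
  by (rule point_compose) (auto intro: map_linear map_counit D_map)

text \<open>In \<open>rbm\<close> the three copies of \<open>P\<close> are split off together,
  whereas in the group product \<open>Q\<close> stands before the last one. Cocommutativity
  reconciles the two orders.\<close>

lemma D_rbm:
  assumes P: "coalgebra_point P" and Q: "coalgebra_point Q"
  shows "C.D (\<lambda>a b. rbm (P a) (Q b)) =
    P \<otimes>\<^bsub>points\<^esub> (\<lambda>c. B (P c)) \<otimes>\<^bsub>points\<^esub> Q \<otimes>\<^bsub>points\<^esub> inv\<^bsub>points\<^esub> (\<lambda>c. B (P c))"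
proof
  fix c
  note L = L_intros L_map point_L[OF P] point_L[OF Q]
  \<comment> \<open>\<open>u\<close> holds the first two copies of \<open>P\<close>,
    \<open>v\<close> the third, and \<open>b\<close> is the argument of \<open>Q\<close>; it remains
    to exchange \<open>b\<close> and \<open>v\<close>.\<close>
  define K where "K u b v = C.D (\<lambda>p q. \<mu> (\<mu> (\<mu> (P p) (B (P q))) (Q b)) (S (B (P v)))) u" for u b v
  have K: "L (\<lambda>u. K u b v)" "L (\<lambda>b. K u b v)" "L (\<lambda>v. K u b v)" for u b v
    unfolding K_def by (intro L)+
  have "C.D (\<lambda>a b. rbm (P a) (Q b)) c =
      C.D (\<lambda>a b. C.D (\<lambda>u v. H.D (\<lambda>p q. \<mu> (\<mu> (\<mu> p (B q)) (Q b)) (S (B (P v)))) (P u)) a) c"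
    unfolding rbm_eq by (subst point_comult[OF P]) (intro bilinear_mapI lin_intros lin_map refl)+
  also have "\<dots> = C.D (\<lambda>a b. C.D (\<lambda>u v. K u b v) a) c"
    unfolding K_def by (subst point_comult[OF P]) (intro bilinear_mapI lin_intros lin_map refl)+
  also have "\<dots> = C.D (\<lambda>u y. C.D (\<lambda>v b. K u b v) y) c"
    by (rule C.D_coassoc) (rule K)+
  also have "\<dots> = C.D (\<lambda>u y. C.D (\<lambda>b v. K u b v) y) c"
    by (subst C.D_cocomm) (rule K refl)+
  also have "\<dots> = C.D (\<lambda>a v. C.D (\<lambda>u b. K u b v) a) c"
    by (rule C.D_coassoc[symmetric]) (rule K)+
  also have "\<dots> = (P \<otimes>\<^bsub>points\<^esub> (\<lambda>c. B (P c)) \<otimes>\<^bsub>points\<^esub> Q \<otimes>\<^bsub>points\<^esub> inv\<^bsub>points\<^esub> (\<lambda>c. B (P c))) c"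
    unfolding K_def inv_points[OF point_map[OF P]] mult_points
      C.D_linear[OF linear_mult_right] ..
  finally show "C.D (\<lambda>a b. rbm (P a) (Q b)) c =
    (P \<otimes>\<^bsub>points\<^esub> (\<lambda>c. B (P c)) \<otimes>\<^bsub>points\<^esub> Q \<otimes>\<^bsub>points\<^esub> inv\<^bsub>points\<^esub> (\<lambda>c. B (P c))) c" .
qed

text \<open>By linearity \<open>B\<close> passes under the convolution sum, where the identity
  becomes \<open>map_rbm\<close> term by term.\<close>

sublocale R: rota_baxter_group points "\<lambda>f c. B (f c)"
proof unfold_locales
  fix f g assume "f \<in> carrier points" "g \<in> carrier points"
  then have f: "coalgebra_point f" and g: "coalgebra_point g" by (simp_all add: carrier_points)
  show "(\<lambda>c. B (f c)) \<otimes>\<^bsub>points\<^esub> (\<lambda>c. B (g c)) = (\<lambda>c. B ((f \<otimes>\<^bsub>points\<^esub> (\<lambda>c. B (f c)) \<otimes>\<^bsub>points\<^esub> g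
      \<otimes>\<^bsub>points\<^esub> inv\<^bsub>points\<^esub> (\<lambda>c. B (f c))) c))"
    by (simp only: C.D_linear[OF map_linear] map_rbm D_rbm[OF f g, symmetric]) (simp only: mult_points)
qed (simp add: carrier_points point_map)

lemma rb_eq: "coalgebra_point P \<Longrightarrow> coalgebra_point Q \<Longrightarrow> R.rb P Q = C.D (\<lambda>a b. rbm (P a) (Q b))"
  by (simp add: R.rb_def D_rbm)

lemma point_rb: "coalgebra_point P \<Longrightarrow> coalgebra_point Q \<Longrightarrow> coalgebra_point (R.rb P Q)"
  using R.rb_closed by (simp add: carrier_points)

end

section \<open>Generic points and the Hopf algebra with product \<open>rbm\<close>\<close>

context rota_baxter_operator
begin

text \<open>Points of \<open>H\<close>, \<open>H \<otimes> H\<close> and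
  \<open>(H \<otimes> H) \<otimes> H\<close>: \<open>HH\<close> and \<open>HHH\<close> provide
  projections, while \<open>H\<close>, \<open>HH'\<close> and \<open>HHH'\<close> provide
  Rota-Baxter groups.\<close>

interpretation H: rb_points scale \<mu> \<Delta> \<eta> \<epsilon> S B "Vector_Spaces.linear scale scale" "\<lambda>x. rep (\<Delta> x)" \<epsilon>
  by unfold_locales

interpretation HH: hopf_points_pair scale \<mu> \<Delta> \<eta> \<epsilon> S
  "Vector_Spaces.linear scale scale" "\<lambda>x. rep (\<Delta> x)" \<epsilon>
  "Vector_Spaces.linear scale scale" "\<lambda>x. rep (\<Delta> x)" \<epsilon>
  by unfold_locales

interpretation HH': rb_points scale \<mu> \<Delta> \<eta> \<epsilon> S B
  "prod_linear (Vector_Spaces.linear scale scale) (Vector_Spaces.linear scale scale)"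
  "prod_comult (\<lambda>x. rep (\<Delta> x)) (\<lambda>x. rep (\<Delta> x))" "\<lambda>(c, d). \<epsilon> c * \<epsilon> d"
  by unfold_locales

interpretation HHH: hopf_points_pair scale \<mu> \<Delta> \<eta> \<epsilon> S
  "prod_linear (Vector_Spaces.linear scale scale) (Vector_Spaces.linear scale scale)"
  "prod_comult (\<lambda>x. rep (\<Delta> x)) (\<lambda>x. rep (\<Delta> x))" "\<lambda>(c, d). \<epsilon> c * \<epsilon> d"
  "Vector_Spaces.linear scale scale" "\<lambda>x. rep (\<Delta> x)" \<epsilon>
  by unfold_locales

interpretation HHH': rb_points scale \<mu> \<Delta> \<eta> \<epsilon> S B
  "prod_linear (prod_linear (Vector_Spaces.linear scale scale) (Vector_Spaces.linear scale scale))
    (Vector_Spaces.linear scale scale)"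
  "prod_comult (prod_comult (\<lambda>x. rep (\<Delta> x)) (\<lambda>x. rep (\<Delta> x))) (\<lambda>x. rep (\<Delta> x))"
  "\<lambda>(c, d). (case c of (c, d) \<Rightarrow> \<epsilon> c * \<epsilon> d) * \<epsilon> d"
  by unfold_locales

text \<open>The generic element of \<open>H\<close>: a group identity for this point is an identity
  for all \<open>x\<close>.\<close>

lemma point_id: "H.coalgebra_point (\<lambda>x. x)"
  by (simp add: H.coalgebra_point_def lin_id)

definition pr1 :: "'a \<times> 'a \<Rightarrow> 'a" where "pr1 = HH.left (\<lambda>x. x)"
definition pr2 :: "'a \<times> 'a \<Rightarrow> 'a" where "pr2 = HH.right (\<lambda>x. x)"

lemma point_pr: "HH.P.coalgebra_point pr1" "HH.P.coalgebra_point pr2"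
  unfolding pr1_def pr2_def by (intro HH.point_left HH.point_right point_id)+

lemma D_pr: "bilinear_map scale scale t \<Longrightarrow> HH.P.C.D (\<lambda>a b. t (pr1 a) (pr2 b)) (x, y) = t x y"
  unfolding pr1_def pr2_def by (rule HH.D_left_right) (auto intro: point_id lin_id)

text \<open>The new product is thereby a product in the Rota-Baxter group on points of
  \<open>H \<otimes> H\<close>, so closure of that group makes it a coalgebra map.\<close>

lemma rb_pr: "HH'.R.rb pr1 pr2 = (\<lambda>(x, y). rbm x y)"
  by (auto simp: HH'.rb_eq[OF point_pr] D_pr bilinear_rbm)

lemma point_rbm: "HH.P.coalgebra_point (\<lambda>(x, y). rbm x y)"
  unfolding rb_pr[symmetric] by (rule HH'.point_rb[OF point_pr])

text \<open>Associativity in the group of points of \<open>H \<otimes> H \<otimes> H\<close>, evaluated at \<open>x \<otimes> y \<otimes> z\<close>.\<close>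

lemma rbm_assoc: "rbm (rbm x y) z = rbm x (rbm y z)"
proof -
  \<comment> \<open>The three projections, that is, a generic triple of elements.\<close>
  let ?X = "HHH.left pr1" and ?Y = "HHH.left pr2" and ?Z = "HHH.right (\<lambda>x. x)"
  note point = HHH.point_left[OF point_pr(1)] HHH.point_left[OF point_pr(2)]
    HHH.point_right[OF point_id]
  note bil = bilinear_rbm
  \<comment> \<open>The first two projections come from \<open>H \<otimes> H\<close>, and so does
    their product.\<close>
  have XY: "HHH'.R.rb ?X ?Y = HHH.left (\<lambda>(x, y). rbm x y)"
  proof
    fix c :: "('a \<times> 'a) \<times> 'a"
    obtain x y z where c: "c = ((x, y), z)" by (metis surj_pair)
    show "HHH'.R.rb ?X ?Y c = HHH.left (\<lambda>(x, y). rbm x y) c"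
      unfolding c HHH'.rb_eq[OF point(1,2)] HHH.D_left[OF bil HHH.P.point_L[OF point(2)]]
      by (simp add: HHH.left_def H.bilinear_map_scale[OF bil] HH.P.C.D_scale D_pr[OF bil])
  qed
  have YZ: "HHH'.R.rb ?Y ?Z (c, z) = rbm (pr2 c) z" for c z
    unfolding HHH'.rb_eq[OF point(2,3)]
    by (rule HHH.D_left_right[OF bil HH.P.point_L[OF point_pr(2)] point_id])
  have "HHH'.R.rb (HHH'.R.rb ?X ?Y) ?Z ((x, y), z) = rbm (rbm x y) z"
    unfolding XY HHH'.rb_eq[OF HHH.point_left[OF point_rbm] point(3)]
    by (subst HHH.D_left_right[OF bil HH.P.point_L[OF point_rbm] point_id]) simp
  moreover have "HHH'.R.rb ?X (HHH'.R.rb ?Y ?Z) ((x, y), z) = rbm x (rbm y z)"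
  proof -
    \<comment> \<open>After \<open>?Z\<close> has been evaluated at \<open>z\<close>, a bilinear
      expression in \<open>pr1\<close> and \<open>pr2\<close> remains, which \<open>D_pr\<close>
      evaluates.\<close>
    have "bilinear_map scale scale (\<lambda>p q. rbm p (rbm q z))"
      by (intro bilinear_mapI bilinear_map_apply[OF bil] lin_id)
    from D_pr[OF this] show ?thesis
      unfolding HHH'.rb_eq[OF point(1) HHH'.point_rb[OF point(2,3)]]
        HHH.D_left[OF bil HHH.P.point_L[OF HHH'.point_rb[OF point(2,3)]]] YZ by simp
  qed
  moreover have "HHH'.R.rb (HHH'.R.rb ?X ?Y) ?Z = HHH'.R.rb ?X (HHH'.R.rb ?Y ?Z)"
    using point by (intro HHH'.R.rb_assoc) (simp_all add: HHH.P.carrier_points)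
  ultimately show ?thesis by simp
qed

text \<open>The unit laws of the Rota-Baxter group at the identity point; the counit inside
  \<open>\<one>\<close> disappears by the counit law of \<open>H\<close>.\<close>

lemma rbm_one: "rbm (\<eta> 1) x = x" "rbm x (\<eta> 1) = x"
proof -
  note lin = bilinear_map_apply[OF bilinear_rbm lin_id]
  have "H.R.rb \<one>\<^bsub>H.points\<^esub> (\<lambda>x. x) x = rbm (\<eta> 1) x"
    by (simp add: H.one_points H.rb_eq[OF H.point_one point_id]
        H.bilinear_map_scale[OF bilinear_rbm] H.D_counit_left[OF lin(2)])
  then show "rbm (\<eta> 1) x = x"
    using H.R.rb_one_left[of "\<lambda>x. x"] by (simp add: H.carrier_points point_id)
  have "H.R.rb (\<lambda>x. x) \<one>\<^bsub>H.points\<^esub> x = rbm x (\<eta> 1)"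
    by (simp add: H.one_points H.rb_eq[OF point_id H.point_one]
        H.bilinear_map_scale[OF bilinear_rbm] H.D_counit_right[OF lin(1)])
  then show "rbm x (\<eta> 1) = x"
    using H.R.rb_one_right[of "\<lambda>x. x"] by (simp add: H.carrier_points point_id)
qed

text \<open>\<open>tensor2_eqI\<close> leads back from bilinear tests, which
  \<open>point_rbm\<close> passes, to an equality of tensors.\<close>

lemma comult_rbm:
  "\<Delta> (rbm x y) = coset (relators2 scale)
    (sweedler fscale \<Delta> (\<lambda>a b. sweedler fscale \<Delta> (\<lambda>c d. gen (rbm a c, rbm b d)) y) x)"
proof -
  have "coset (relators2 scale) (rep (\<Delta> (rbm x y))) = coset (relators2 scale)
    (sweedler fscale \<Delta> (\<lambda>a b. sweedler fscale \<Delta> (\<lambda>c d. gen (rbm a c, rbm b d)) y) x)"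
  proof (rule tensor2_eqI[OF vector_space_axioms one_neq_zero])
    fix t assume "bilinear_map scale scale t"
    from HH.P.point_comult[OF point_rbm this, of "(x, y)"]
    show "extend scale (\<lambda>(a, b). t a b) (rep (\<Delta> (rbm x y))) = extend scale (\<lambda>(a, b). t a b)
        (sweedler fscale \<Delta> (\<lambda>a b. sweedler fscale \<Delta> (\<lambda>c d. gen (rbm a c, rbm b d)) y) x)"
      by (simp add: extend_sweedler sweedler_eq_D HH.P_D) (simp add: H.D_def)
  qed
  then show ?thesis by (simp add: coset_rep comult_in)
qed

lemma counit_rbm: "\<epsilon> (rbm x y) = \<epsilon> x * \<epsilon> y"
  using HH.P.point_counit[OF point_rbm, of "(x, y)"] by simp

abbreviation rba where "rba \<equiv> rb_antipode scale \<mu> \<Delta> S B"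

lemma rba_eq: "rba = H.R.rb_inv (\<lambda>x. x)"
  by (rule ext) (simp add: rb_antipode_def sweedler3_def sweedler_eq_D H.R.rb_inv_def H.mult_points
      H.inv_points H.point_map point_id H.D_linear[OF linear_mult_right])

text \<open>Besides entering the inverse laws, this supplies the linearity required of an
  antipode.\<close>

lemma point_rba: "H.coalgebra_point rba"
proof -
  have "rba \<in> carrier H.points"
    unfolding rba_eq H.R.rb_inv_def
    by (intro H.G.m_closed H.G.inv_closed) (simp_all add: H.carrier_points H.point_map point_id)
  then show ?thesis by (simp add: H.carrier_points)
qed

text \<open>By \<open>rba_eq\<close> these are the inverse laws of the Rota-Baxter group at the
  identity point.\<close>

lemma rba_inverse: "H.D (\<lambda>a b. rbm (rba a) b) x = scale (\<epsilon> x) (\<eta> 1)"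
  "H.D (\<lambda>a b. rbm a (rba b)) x = scale (\<epsilon> x) (\<eta> 1)"
  using H.R.rb_inv_left[of "\<lambda>x. x"] H.R.rb_inv_right[of "\<lambda>x. x"] point_id point_rba
  by (simp_all add: H.carrier_points H.rb_eq H.one_points fun_eq_iff flip: rba_eq)

lemma cocommutative_hopf_algebra_rb:
  "cocommutative_hopf_algebra scale rbm \<Delta> \<eta> \<epsilon> rba"
proof -
  have scale: "rbm (\<eta> c) x = scale c x" "rbm x (\<eta> c) = scale c x" for c x
    unfolding unit_eq[of c] by (simp_all add: H.bilinear_map_scale[OF bilinear_rbm] rbm_one)
  have "unital_algebra scale rbm \<eta>"
    by (intro unital_algebra.intro unital_algebra_axioms.intro vector_space_axioms bilinear_rbm
        unit_linear rbm_assoc scale)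
  then have "bialgebra scale rbm \<Delta> \<eta> \<epsilon>"
    by (intro bialgebra.intro bialgebra_axioms.intro counital_coalgebra_axioms comult_rbm
        comult_one counit_rbm counit_one)
  then show ?thesis
    by (intro cocommutative_hopf_algebra.intro cocommutative_hopf_algebra_axioms.intro
        hopf_algebra.intro hopf_algebra_axioms.intro cocommutative H.point_L[OF point_rba])
      (simp_all add: sweedler_eq_D rba_inverse flip: unit_eq)
qed

end

theorem theorem4:
  fixes scale :: "'f::field_char_0 \<Rightarrow> 'a::ab_group_add \<Rightarrow> 'a"
    and \<mu> :: "'a \<Rightarrow> 'a \<Rightarrow> 'a" and \<Delta> :: "'a \<Rightarrow> ('a, 'f) tensor2"
    and \<eta> :: "'f \<Rightarrow> 'a" and \<epsilon> :: "'a \<Rightarrow> 'f" and S :: "'a \<Rightarrow> 'a" and B :: "'a \<Rightarrow> 'a"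
  assumes "cocommutative_hopf_algebra scale \<mu> \<Delta> \<eta> \<epsilon> S"
    and "rota_baxter_operator scale \<mu> \<Delta> \<eta> \<epsilon> S B"
  shows "cocommutative_hopf_algebra scale (rb_mult scale \<mu> \<Delta> S B) \<Delta> \<eta> \<epsilon>
    (rb_antipode scale \<mu> \<Delta> S B)"
  using assms(2) by (rule rota_baxter_operator.cocommutative_hopf_algebra_rb)

end
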